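(* Let $n\geq 1$ and let $\Gamma$ be a signed graph that is cospectral with the path $P_n$ but not switching isomorphic with $P_n$. Then $\Gamma$ contains an unbalanced $4$-cycle as an induced subgraph.
   Context: A signed graph $\Gamma=(G,\sigma)$ is a simple graph $G=(V,E)$ together with a map $\sigma:E\to\{-1,+1\}$. Its adjacency matrix is obtained from the $(0,1)$-adjacency matrix of $G$ by replacing the entry $1$ by $-1$ for each negative edge; the spectrum of $\Gamma$ is the spectrum of this matrix. Two signed graphs are cospectral if they have the same spectrum. Switching with respect to a vertex subset $X$ changes the sign of every edge with exactly one end in $X$; two signed graphs are switching isomorphic if one can be switched into a signed graph isomorphic to the other. The path $P_n$ is regarded as a signed graph with all edges positive. A cycle is unbalanced if it contains an odd number of negative edges. An induced subgraph is the subgraph induced on a vertex subset, with the inherited signs. *)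

theory Defs
  imports
    "Jordan_Normal_Form.Char_Poly"
    "HOL-Computational_Algebra.Fundamental_Theorem_Algebra"
    "HOL-Combinatorics.List_Permutation"
begin

text \<open>Edges are two-element vertex sets. The values of \<open>edge_sign\<close> outside the edge set are
  irrelevant.\<close>

record 'a sgraph =
  verts :: "'a set"
  edges :: "'a set set"
  edge_sign :: "'a set \<Rightarrow> int"

definition signed_graph :: "'a sgraph \<Rightarrow> bool" where
  "signed_graph G \<longleftrightarrow>
     finite (verts G) \<and>
     (\<forall>e\<in>edges G. e \<subseteq> verts G \<and> card e = 2) \<and>
     (\<forall>e\<in>edges G. edge_sign G e \<in> {-1, 1})"

text \<open>The adjacency matrix with respect to an enumeration \<open>vs\<close> of the vertices.\<close>

definition adjacency_matrix :: "'a list \<Rightarrow> 'a sgraph \<Rightarrow> int mat" where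
  "adjacency_matrix vs G = mat (length vs) (length vs)
     (\<lambda>(i, j). if {vs ! i, vs ! j} \<in> edges G then edge_sign G {vs ! i, vs ! j} else 0)"

definition matrix_spectrum :: "int mat \<Rightarrow> complex multiset" where
  "matrix_spectrum A = proots (char_poly (map_mat complex_of_int A))"

text \<open>The spectrum is the multiset of eigenvalues. The choice of the enumeration is immaterial,
  see \<open>graph_spectrum_eq\<close> below.\<close>

definition graph_spectrum :: "'a sgraph \<Rightarrow> complex multiset" where
  "graph_spectrum G =
     matrix_spectrum (adjacency_matrix (SOME vs. distinct vs \<and> set vs = verts G) G)"

definition cospectral :: "'a sgraph \<Rightarrow> 'b sgraph \<Rightarrow> bool" where
  "cospectral G H \<longleftrightarrow> graph_spectrum G = graph_spectrum H"

definition switch :: "'a set \<Rightarrow> 'a sgraph \<Rightarrow> 'a sgraph" where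
  "switch X G = G\<lparr>edge_sign := (\<lambda>e. if card (e \<inter> X) = 1 then - edge_sign G e else edge_sign G e)\<rparr>"

definition isomorphic :: "'a sgraph \<Rightarrow> 'b sgraph \<Rightarrow> bool" where
  "isomorphic G H \<longleftrightarrow>
     (\<exists>f. bij_betw f (verts G) (verts H) \<and>
          edges H = (\<lambda>e. f ` e) ` edges G \<and>
          (\<forall>e\<in>edges G. edge_sign H (f ` e) = edge_sign G e))"

definition switching_isomorphic :: "'a sgraph \<Rightarrow> 'b sgraph \<Rightarrow> bool" where
  "switching_isomorphic G H \<longleftrightarrow> (\<exists>X\<subseteq>verts G. isomorphic (switch X G) H)"

definition path_graph :: "nat \<Rightarrow> nat sgraph" where
  "path_graph n =
     \<lparr>verts = {..<n}, edges = {{i, Suc i} | i. Suc i < n}, edge_sign = (\<lambda>_. 1)\<rparr>"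

definition induced_subgraph :: "'a sgraph \<Rightarrow> 'a set \<Rightarrow> 'a sgraph" where
  "induced_subgraph G X = G\<lparr>verts := X, edges := {e \<in> edges G. e \<subseteq> X}\<rparr>"

definition is_cycle :: "nat \<Rightarrow> 'a sgraph \<Rightarrow> bool" where
  "is_cycle k G \<longleftrightarrow>
     3 \<le> k \<and>
     (\<exists>f. bij_betw f {..<k} (verts G) \<and>
          edges G = (\<lambda>i. {f i, f (Suc i mod k)}) ` {..<k})"

definition unbalanced_cycle :: "nat \<Rightarrow> 'a sgraph \<Rightarrow> bool" where
  "unbalanced_cycle k G \<longleftrightarrow>
     is_cycle k G \<and> odd (card {e \<in> edges G. edge_sign G e = -1})"

lemma signed_graph_path_graph: "signed_graph (path_graph n)"
  by (auto simp: signed_graph_def path_graph_def)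

lemma signed_graph_switch: "signed_graph G \<Longrightarrow> signed_graph (switch X G)"
  by (auto simp: signed_graph_def switch_def)

lemma signed_graph_induced_subgraph:
  "signed_graph G \<Longrightarrow> X \<subseteq> verts G \<Longrightarrow> signed_graph (induced_subgraph G X)"
  by (auto simp: signed_graph_def induced_subgraph_def intro: finite_subset)

lemma char_poly_permute:
  fixes A :: "'a :: comm_ring_1 mat"
  assumes A: "A \<in> carrier_mat n n" and p: "p permutes {0..<n}"
  shows "char_poly (mat n n (\<lambda>(i, j). A $$ (p i, p j))) = char_poly A"
proof -
  let ?C = "char_poly_matrix A"
  have pn: "p i < n \<longleftrightarrow> i < n" for i
    using permutes_in_image[OF p, of i] by simp
  have C: "?C \<in> carrier_mat n n" using A by simp
  define D where "D = transpose_mat (mat n n (\<lambda>(i, j). ?C $$ (p i, j)))"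
  have D: "D \<in> carrier_mat n n" by (simp add: D_def)
  have "char_poly_matrix (mat n n (\<lambda>(i, j). A $$ (p i, p j)))
      = transpose_mat (mat n n (\<lambda>(i, j). D $$ (p i, j)))"
    using A pn permutes_inj[OF p]
    by (intro eq_matI) (auto simp: D_def char_poly_matrix_def inj_eq)
  hence "char_poly (mat n n (\<lambda>(i, j). A $$ (p i, p j))) = signof p * (signof p * det ?C)"
    by (simp add: char_poly_def det_transpose[of _ n] det_permute_rows[OF D p])
      (simp add: D_def det_transpose[of _ n] det_permute_rows[OF C p])
  also have "\<dots> = det ?C"
    by (simp add: sign_def)
  finally show ?thesis by (simp add: char_poly_def)
qed

lemma matrix_spectrum_adjacency_matrix_cong:
  assumes "distinct vs" "distinct ws" "set vs = set ws"
  shows "matrix_spectrum (adjacency_matrix vs G) = matrix_spectrum (adjacency_matrix ws G)"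
proof -
  let ?n = "length ws"
  have "mset vs = mset ws"
    using assms set_eq_iff_mset_eq_distinct by blast
  then obtain p where p: "p permutes {..<?n}" and vs: "permute_list p ws = vs"
    using mset_eq_permutation by blast
  let ?A = "map_mat complex_of_int (adjacency_matrix ws G)"
  have p': "p permutes {0..<?n}" using p by (simp add: lessThan_atLeast0)
  have pn: "p i < ?n \<longleftrightarrow> i < ?n" for i
    using permutes_in_image[OF p, of i] by simp
  have "map_mat complex_of_int (adjacency_matrix vs G)
      = mat ?n ?n (\<lambda>(i, j). ?A $$ (p i, p j))"
    using vs[symmetric] pn by (intro eq_matI) (auto simp: adjacency_matrix_def permute_list_nth[OF p])
  moreover have "?A \<in> carrier_mat ?n ?n" by (simp add: adjacency_matrix_def)
  ultimately show ?thesis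
    unfolding matrix_spectrum_def using char_poly_permute[OF _ p'] by metis
qed

lemma graph_spectrum_eq:
  assumes "distinct vs" "set vs = verts G"
  shows "graph_spectrum G = matrix_spectrum (adjacency_matrix vs G)"
proof -
  let ?ws = "SOME vs. distinct vs \<and> set vs = verts G"
  have "distinct ?ws \<and> set ?ws = verts G"
    using assms by (intro someI[of "\<lambda>vs. distinct vs \<and> set vs = verts G" vs]) simp
  thus ?thesis
    unfolding graph_spectrum_def using assms
    by (intro matrix_spectrum_adjacency_matrix_cong) auto
qed

end

theory Submission
  imports Defs "Jordan_Normal_Form.Schur_Decomposition"
begin

text \<open>Let \<open>A\<close> be the adjacency matrix of \<open>\<Gamma>\<close> and \<open>t = \<pi> / (n + 1)\<close>. Cospectrality transfers the traces of
  all powers and the eigenvalue \<open>2 cos t\<close> from \<open>P\<^sub>n\<close> to \<open>\<Gamma>\<close>. The positive eigenvector \<open>sin ((i + 1) t)\<close>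
  of \<open>P\<^sub>n\<close> bounds the traces by \<open>n (2 cos t)\<^sup>k\<close>. On the other hand
  \<open>(x \<cdot> A\<^sup>k x)\<^sup>2 \<le> (x \<cdot> x) (x \<cdot> A\<^sup>2\<^sup>k x)\<close> and \<open>x \<cdot> A\<^sup>2\<^sup>k x \<le> (x \<cdot> x) tr A\<^sup>2\<^sup>k\<close>, so repeated squaring
  excludes \<open>\<bar>x \<cdot> A x\<bar> \<ge> 2 (x \<cdot> x)\<close> for \<open>x \<noteq> 0\<close>. Hence \<open>\<Gamma>\<close> has no triangles and no balanced 4-cycles.

  If there were no induced unbalanced 4-cycle either, then \<open>tr A\<^sup>4\<close> would be \<open>\<Sum> (2 d\<^sup>2 - d)\<close> over the
  degrees \<open>d\<close>, as for \<open>P\<^sub>n\<close>, and comparing with \<open>tr A\<^sup>2 = \<Sum> d\<close> gives \<open>\<Sum> (d - 1) (d - 2) = 0\<close>. So all degrees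
  are 1 or 2, and \<open>\<Gamma>\<close> is a path together with disjoint cycles. An eigenfunction for \<open>2 cos t\<close>
  satisfies the recurrence of \<open>sin (i t)\<close> along each component, up to signs, and must vanish on a path
  with fewer than \<open>n\<close> vertices and on a (balanced or unbalanced) cycle with at most \<open>n\<close> vertices. So the
  path is everything.\<close>

section \<open>Traces and eigenvalues of cospectral graphs\<close>

definition adj :: "'a sgraph \<Rightarrow> 'a \<Rightarrow> 'a \<Rightarrow> real" where
  "adj G u v = (if {u, v} \<in> edges G then real_of_int (edge_sign G {u, v}) else 0)"

text \<open>The entries of the powers of the adjacency matrix, that is, walks counted with the
  product of their signs. Indexing by vertices keeps the later arguments free of a chosen
  enumeration.\<close>

primrec walks :: "'a sgraph \<Rightarrow> nat \<Rightarrow> 'a \<Rightarrow> 'a \<Rightarrow> real" where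
  "walks G 0 u v = (if u = v then 1 else 0)"
| "walks G (Suc k) u v = (\<Sum>w\<in>verts G. walks G k u w * adj G w v)"

definition eigenfun :: "'a sgraph \<Rightarrow> real \<Rightarrow> ('a \<Rightarrow> real) \<Rightarrow> bool" where
  "eigenfun G r f \<longleftrightarrow>
     (\<exists>u\<in>verts G. f u \<noteq> 0) \<and> (\<forall>u\<in>verts G. (\<Sum>w\<in>verts G. adj G u w * f w) = r * f u)"

text \<open>A term of \<open>B ^\<^sub>m k * B\<close> at \<open>(i, j)\<close> with middle index
  \<open>l\<close> can be nonzero only for i \<le> l \<le> j. Below the diagonal no such
  \<open>l\<close> exists, and on it only \<open>l = i\<close> remains.\<close>

lemma upper_triangular_pow_diag:
  fixes B :: "'a :: comm_ring_1 mat"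
  assumes B: "B \<in> carrier_mat n n" and ut: "upper_triangular B"
  shows "upper_triangular (B ^\<^sub>m k) \<and> (\<forall>i<n. (B ^\<^sub>m k) $$ (i, i) = (B $$ (i, i)) ^ k)"
proof (induction k)
  case 0
  show ?case using B by auto
next
  case (Suc k)
  have C: "B ^\<^sub>m k \<in> carrier_mat n n" using B by simp
  have entry: "(B ^\<^sub>m Suc k) $$ (i, j) = (\<Sum>l\<in>{0..<n}. (B ^\<^sub>m k) $$ (i, l) * B $$ (l, j))"
    if "i < n" "j < n" for i j
    using that B C by (simp add: scalar_prod_def)
  have z1: "(B ^\<^sub>m k) $$ (i, l) = 0" if "l < i" "i < n" for i l
    using Suc that C by auto
  have z2: "B $$ (l, j) = 0" if "j < l" "l < n" for l j
    using ut that B by auto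
  have "(B ^\<^sub>m Suc k) $$ (i, j) = 0" if "j < i" "i < n" for i j
  proof -
    have "(B ^\<^sub>m k) $$ (i, l) * B $$ (l, j) = 0" if "l < n" for l
      using z1[of l i] z2[of j l] that \<open>j < i\<close> \<open>i < n\<close> by (cases "l < i") auto
    thus ?thesis using entry[of i j] that by simp
  qed
  moreover have "(B ^\<^sub>m Suc k) $$ (i, i) = (B $$ (i, i)) ^ Suc k" if i: "i < n" for i
  proof -
    have "(B ^\<^sub>m k) $$ (i, l) * B $$ (l, i) = 0" if "l < n" "l \<noteq> i" for l
      using z1[of l i] z2[of i l] that i by (cases "l < i") auto
    hence "(B ^\<^sub>m Suc k) $$ (i, i) = (\<Sum>l\<in>{i}. (B ^\<^sub>m k) $$ (i, l) * B $$ (l, i))"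
      unfolding entry[OF i i] using i by (intro sum.mono_neutral_right) auto
    thus ?thesis using Suc i by (simp add: mult.commute)
  qed
  ultimately show ?case using B by auto
qed

lemma trace_mult_commute:
  fixes A B :: "'a :: comm_ring_1 mat"
  assumes "A \<in> carrier_mat n n" "B \<in> carrier_mat n n"
  shows "(\<Sum>i<n. (A * B) $$ (i, i)) = (\<Sum>i<n. (B * A) $$ (i, i))"
proof -
  have "(\<Sum>i<n. (A * B) $$ (i, i)) = (\<Sum>i<n. \<Sum>j<n. A $$ (i, j) * B $$ (j, i))"
    using assms by (simp add: scalar_prod_def lessThan_atLeast0)
  also have "\<dots> = (\<Sum>j<n. \<Sum>i<n. A $$ (i, j) * B $$ (j, i))"
    by (rule sum.swap)
  also have "\<dots> = (\<Sum>i<n. (B * A) $$ (i, i))"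
    using assms by (simp add: scalar_prod_def lessThan_atLeast0 mult.commute)
  finally show ?thesis .
qed

text \<open>Schur triangularization: the trace of a power is invariant under similarity, and the
  diagonal of the triangular form is \<open>es\<close>. Hence the characteristic polynomial
  determines the traces of all powers.\<close>

lemma trace_pow_char_poly:
  fixes A :: "complex mat"
  assumes A: "A \<in> carrier_mat n n" and c: "char_poly A = (\<Prod>e\<leftarrow>es. [:- e, 1:])"
  shows "(\<Sum>i<n. (A ^\<^sub>m k) $$ (i, i)) = (\<Sum>e\<leftarrow>es. e ^ k)"
proof -
  obtain B P Q where "schur_decomposition A es = (B, P, Q)"
    by (cases "schur_decomposition A es")
  with schur_decomposition[OF A c] have w: "similar_mat_wit A B P Q"
    and ut: "upper_triangular B" and d: "diag_mat B = es" by auto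
  from similar_mat_witD2[OF A w] have car: "B \<in> carrier_mat n n" "P \<in> carrier_mat n n"
    "Q \<in> carrier_mat n n" and QP: "Q * P = 1\<^sub>m n" by auto
  have Bk: "B ^\<^sub>m k \<in> carrier_mat n n" using car by simp
  have "A ^\<^sub>m k = P * (B ^\<^sub>m k * Q)"
    using similar_mat_wit_pow_id[OF w, of k] car Bk by (simp add: assoc_mult_mat[of _ n n _ n _ n])
  moreover have "B ^\<^sub>m k * Q * P = B ^\<^sub>m k"
    using car Bk QP by (simp add: assoc_mult_mat[of _ n n _ n _ n])
  ultimately have "(\<Sum>i<n. (A ^\<^sub>m k) $$ (i, i)) = (\<Sum>i<n. (B ^\<^sub>m k) $$ (i, i))"
    using trace_mult_commute[OF car(2) mult_carrier_mat[OF Bk car(3)]] by (simp only:)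
  also have "\<dots> = (\<Sum>i<n. (B $$ (i, i)) ^ k)"
    using upper_triangular_pow_diag[OF car(1) ut] by simp
  also have "\<dots> = (\<Sum>e\<leftarrow>es. e ^ k)"
    unfolding d[symmetric] diag_mat_def using car
    by (simp add: interv_sum_list_conv_sum_set_nat lessThan_atLeast0 o_def)
  finally show ?thesis .
qed

text \<open>Cospectrality speaks only of the multiset of roots. Over the complex numbers a monic
  polynomial is the product of its linear factors, so this multiset recovers it.\<close>

lemma proots_monic_unique:
  fixes p q :: "complex poly"
  assumes "monic p" "monic q" "proots p = proots q"
  shows "p = q"
proof -
  have "r = (\<Prod>x\<in>#proots r. [:-x, 1:])" if "monic r" for r :: "complex poly"
    using complex_poly_decompose_multiset[of r] that by simp
  thus ?thesis using assms by metis
qed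

lemma sum_nth_distinct:
  assumes "distinct vs"
  shows "(\<Sum>i<length vs. f (vs ! i)) = sum f (set vs)"
  using assms by (metis bij_betw_nth sum.reindex_bij_betw)

lemma adjacency_pow_eq_walks:
  assumes vs: "distinct vs" "set vs = verts G"
  shows "i < length vs \<Longrightarrow> j < length vs \<Longrightarrow>
    (map_mat complex_of_int (adjacency_matrix vs G) ^\<^sub>m k) $$ (i, j) = of_real (walks G k (vs ! i) (vs ! j))"
proof (induction k arbitrary: j)
  case 0
  then show ?case using vs by (auto simp: adjacency_matrix_def nth_eq_iff_index_eq)
next
  case (Suc k)
  let ?A = "map_mat complex_of_int (adjacency_matrix vs G)"
  have A: "?A \<in> carrier_mat (length vs) (length vs)" by (simp add: adjacency_matrix_def)
  have e: "?A $$ (l, j) = of_real (adj G (vs ! l) (vs ! j))" if "l < length vs" for l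
    using that Suc.prems by (simp add: adjacency_matrix_def adj_def)
  have "(?A ^\<^sub>m Suc k) $$ (i, j) = (\<Sum>l<length vs. (?A ^\<^sub>m k) $$ (i, l) * ?A $$ (l, j))"
    using Suc.prems A by (simp add: scalar_prod_def lessThan_atLeast0)
  also have "\<dots> = (\<Sum>l<length vs. of_real (walks G k (vs ! i) (vs ! l) * adj G (vs ! l) (vs ! j)))"
    using Suc e by (intro sum.cong) auto
  also have "\<dots> = of_real (walks G (Suc k) (vs ! i) (vs ! j))"
    using sum_nth_distinct[OF vs(1), of "\<lambda>w. walks G k (vs ! i) w * adj G w (vs ! j)"] vs(2)
    by (simp flip: of_real_mult of_real_sum)
  finally show ?case .
qed

lemma eigenvalue_adjacency_iff:
  assumes vs: "distinct vs" "set vs = verts G"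
  shows "eigenvalue (map_mat real_of_int (adjacency_matrix vs G)) r \<longleftrightarrow> (\<exists>f. eigenfun G r f)"
proof -
  let ?n = "length vs" and ?A = "map_mat real_of_int (adjacency_matrix vs G)"
  have A: "?A \<in> carrier_mat ?n ?n" by (simp add: adjacency_matrix_def)
  have mv: "(?A *\<^sub>v v) $ i = (\<Sum>w\<in>verts G. adj G (vs ! i) w * f w)"
    if "v \<in> carrier_vec ?n" "\<And>i. i < ?n \<Longrightarrow> v $ i = f (vs ! i)" "i < ?n" for v f i
  proof -
    have "(?A *\<^sub>v v) $ i = (\<Sum>l<?n. adj G (vs ! i) (vs ! l) * f (vs ! l))"
      using that by (auto simp: adjacency_matrix_def scalar_prod_def lessThan_atLeast0 adj_def intro!: sum.cong)
    thus ?thesis using sum_nth_distinct[OF vs(1), of "\<lambda>w. adj G (vs ! i) w * f w"] vs(2) by simp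
  qed
  show ?thesis
  proof
    assume "eigenvalue ?A r"
    then obtain v where v: "v \<in> carrier_vec ?n" "v \<noteq> 0\<^sub>v ?n" "?A *\<^sub>v v = r \<cdot>\<^sub>v v"
      unfolding eigenvalue_def eigenvector_def by (auto simp: adjacency_matrix_def)
    define f where "f u = v $ (the_inv_into {..<?n} ((!) vs) u)" for u
    have inj: "inj_on ((!) vs) {..<?n}" using vs(1) by (simp add: inj_on_nth)
    have f: "v $ i = f (vs ! i)" if "i < ?n" for i
      using the_inv_into_f_f[OF inj, of i] that by (simp add: f_def)
    have "(\<Sum>w\<in>verts G. adj G u w * f w) = r * f u" if u: "u \<in> verts G" for u
    proof -
      obtain i where i: "i < ?n" "vs ! i = u"
        using u unfolding vs(2)[symmetric] in_set_conv_nth by blast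
      have e1: "(?A *\<^sub>v v) $ i = r * v $ i"
        unfolding v(3) by (rule index_smult_vec(1)) (use v(1) i(1) in auto)
      have e2: "(?A *\<^sub>v v) $ i = (\<Sum>w\<in>verts G. adj G u w * f w)"
        unfolding i(2)[symmetric] by (rule mv[OF v(1) _ i(1)]) (rule f)
      show ?thesis using trans[OF e2[symmetric] e1] unfolding f[OF i(1)] i(2) .
    qed
    moreover have "\<exists>i<?n. v $ i \<noteq> 0"
    proof (rule ccontr)
      assume "\<not> ?thesis"
      hence "v = 0\<^sub>v ?n" using v(1) by (intro eq_vecI) auto
      thus False using v(2) by contradiction
    qed
    then obtain i where "i < ?n" "f (vs ! i) \<noteq> 0" using f by auto
    hence "\<exists>u\<in>verts G. f u \<noteq> 0" using vs(2) nth_mem by blast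
    ultimately show "\<exists>f. eigenfun G r f" unfolding eigenfun_def by blast
  next
    assume "\<exists>f. eigenfun G r f"
    then obtain f where f: "eigenfun G r f" by blast
    define v where "v = vec ?n (\<lambda>i. f (vs ! i))"
    have v: "v \<in> carrier_vec ?n" "\<And>i. i < ?n \<Longrightarrow> v $ i = f (vs ! i)" by (auto simp: v_def)
    have "?A *\<^sub>v v = r \<cdot>\<^sub>v v"
    proof (rule eq_vecI)
      fix i assume "i < dim_vec (r \<cdot>\<^sub>v v)"
      hence i: "i < ?n" using v by simp
      hence "vs ! i \<in> verts G" using vs(2) nth_mem by blast
      hence "(\<Sum>w\<in>verts G. adj G (vs ! i) w * f w) = r * f (vs ! i)"
        using f by (simp add: eigenfun_def)
      moreover have "(?A *\<^sub>v v) $ i = (\<Sum>w\<in>verts G. adj G (vs ! i) w * f w)"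
        by (rule mv[OF v(1) _ i]) (rule v(2))
      moreover have "(r \<cdot>\<^sub>v v) $ i = r * f (vs ! i)" using v i by simp
      ultimately show "(?A *\<^sub>v v) $ i = (r \<cdot>\<^sub>v v) $ i" by (simp only:)
    qed (use v A in simp)
    moreover obtain u where "u \<in> verts G" "f u \<noteq> 0" using f by (auto simp: eigenfun_def)
    then obtain i where i: "i < ?n" "f (vs ! i) \<noteq> 0" unfolding vs(2)[symmetric] in_set_conv_nth by blast
    hence "v \<noteq> 0\<^sub>v ?n" using v(2)[OF i(1)] by auto
    ultimately show "eigenvalue ?A r"
      unfolding eigenvalue_def eigenvector_def using v(1) A by auto
  qed
qed

text \<open>The spectrum determines the characteristic polynomial, whose degree, power sums of roots
  and real roots give the three claims.\<close>

lemma cospectral_invariants: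
  assumes G: "finite (verts G)" and H: "finite (verts H)" and "cospectral G H"
  shows "card (verts G) = card (verts H)"
    and "(\<Sum>u\<in>verts G. walks G k u u) = (\<Sum>u\<in>verts H. walks H k u u)"
    and "(\<exists>f. eigenfun G r f) \<longleftrightarrow> (\<exists>f. eigenfun H r f)"
proof -
  obtain vs where vs: "distinct vs" "set vs = verts G" using finite_distinct_list[OF G] by blast
  obtain ws where ws: "distinct ws" "set ws = verts H" using finite_distinct_list[OF H] by blast
  let ?A = "adjacency_matrix vs G" and ?B = "adjacency_matrix ws H"
  let ?cA = "map_mat complex_of_int ?A" and ?cB = "map_mat complex_of_int ?B"
  have carA: "?A \<in> carrier_mat (length vs) (length vs)" "?cA \<in> carrier_mat (length vs) (length vs)"
    and carB: "?B \<in> carrier_mat (length ws) (length ws)" "?cB \<in> carrier_mat (length ws) (length ws)"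
    by (auto simp: adjacency_matrix_def)
  have "proots (char_poly ?cA) = proots (char_poly ?cB)"
    using assms(3) graph_spectrum_eq[OF vs] graph_spectrum_eq[OF ws]
    by (simp add: cospectral_def matrix_spectrum_def)
  hence cp: "char_poly ?cA = char_poly ?cB"
    using degree_monic_char_poly[OF carA(2)] degree_monic_char_poly[OF carB(2)]
    by (intro proots_monic_unique) auto
  hence len: "length vs = length ws"
    using degree_monic_char_poly[OF carA(2)] degree_monic_char_poly[OF carB(2)] by metis
  thus "card (verts G) = card (verts H)"
    using vs ws distinct_card by metis
  have trG: "complex_of_real (\<Sum>u\<in>verts G. walks G k u u) = (\<Sum>i<length vs. (?cA ^\<^sub>m k) $$ (i, i))"
    using sum_nth_distinct[OF vs(1), of "\<lambda>u. complex_of_real (walks G k u u)"] vs(2)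
    by (simp add: adjacency_pow_eq_walks[OF vs])
  have trH: "complex_of_real (\<Sum>u\<in>verts H. walks H k u u) = (\<Sum>i<length ws. (?cB ^\<^sub>m k) $$ (i, i))"
    using sum_nth_distinct[OF ws(1), of "\<lambda>u. complex_of_real (walks H k u u)"] ws(2)
    by (simp add: adjacency_pow_eq_walks[OF ws])
  obtain es where es: "char_poly ?cA = (\<Prod>e\<leftarrow>es. [:- e, 1:])"
    using char_poly_factorized[OF carA(2)] by blast
  show "(\<Sum>u\<in>verts G. walks G k u u) = (\<Sum>u\<in>verts H. walks H k u u)"
    using trace_pow_char_poly[OF carA(2) es, of k] trace_pow_char_poly[OF carB(2) es[unfolded cp], of k]
      trG trH of_real_eq_iff by metis
  \<comment> \<open>Eigenfunctions are real while the spectrum is complex; the integer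
    characteristic polynomial is the common source of both versions.\<close>
  have "map_poly complex_of_int (char_poly ?A) = map_poly complex_of_int (char_poly ?B)"
    using cp of_int_hom.char_poly_hom[OF carA(1)] of_int_hom.char_poly_hom[OF carB(1)] by metis
  hence "char_poly ?A = char_poly ?B"
    by (simp add: of_int_poly_hom.injectivity)
  hence "char_poly (map_mat real_of_int ?A) = char_poly (map_mat real_of_int ?B)"
    using of_int_hom.char_poly_hom[OF carA(1)] of_int_hom.char_poly_hom[OF carB(1)] by metis
  hence "eigenvalue (map_mat real_of_int ?A) r = eigenvalue (map_mat real_of_int ?B) r"
    using eigenvalue_root_char_poly[of "map_mat real_of_int ?A" "length vs" r]
      eigenvalue_root_char_poly[of "map_mat real_of_int ?B" "length ws" r] carA carB by simp
  thus "(\<exists>f. eigenfun G r f) \<longleftrightarrow> (\<exists>f. eigenfun H r f)"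
    using eigenvalue_adjacency_iff[OF vs] eigenvalue_adjacency_iff[OF ws] by simp
qed

section \<open>The quadratic form of the adjacency matrix\<close>

text \<open>Lagrange's identity: the squares of \<open>a i * b j - a j * b i\<close>, summed over
  all pairs, give twice the difference of the two sides.\<close>

lemma Cauchy_Schwarz_sum:
  fixes a b :: "'b \<Rightarrow> real"
  shows "(\<Sum>i\<in>I. a i * b i)\<^sup>2 \<le> (\<Sum>i\<in>I. (a i)\<^sup>2) * (\<Sum>i\<in>I. (b i)\<^sup>2)"
proof -
  have "0 \<le> (\<Sum>i\<in>I. \<Sum>j\<in>I. (a i * b j - a j * b i)\<^sup>2)"
    by (intro sum_nonneg) simp
  also have "\<dots> = (\<Sum>i\<in>I. \<Sum>j\<in>I. (a i)\<^sup>2 * (b j)\<^sup>2) + (\<Sum>i\<in>I. \<Sum>j\<in>I. (b i)\<^sup>2 * (a j)\<^sup>2)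
      - 2 * (\<Sum>i\<in>I. \<Sum>j\<in>I. (a i * b i) * (a j * b j))"
    unfolding sum_distrib_left sum.distrib[symmetric] sum_subtractf[symmetric]
    by (intro sum.cong refl) (simp add: power2_eq_square algebra_simps)
  also have "\<dots> = 2 * ((\<Sum>i\<in>I. (a i)\<^sup>2) * (\<Sum>i\<in>I. (b i)\<^sup>2)) - 2 * (\<Sum>i\<in>I. a i * b i)\<^sup>2"
    unfolding sum_product[symmetric] by (simp add: power2_eq_square)
  finally show ?thesis by simp
qed

lemma adj_commute: "adj G u v = adj G v u"
  by (simp add: adj_def insert_commute)

lemma adj_self: "signed_graph G \<Longrightarrow> adj G u u = 0"
  by (force simp: adj_def signed_graph_def)

lemma adj_square: "signed_graph G \<Longrightarrow> (adj G u v)\<^sup>2 = (if {u, v} \<in> edges G then 1 else 0)"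
  by (auto simp: adj_def signed_graph_def)

lemma walks_Suc_0: "finite (verts G) \<Longrightarrow> u \<in> verts G \<Longrightarrow> walks G (Suc 0) u v = adj G u v"
  by (simp add: sum.delta if_distrib[of "\<lambda>x. x * _"] cong: if_cong)

lemma walks_add:
  assumes "finite (verts G)" "v \<in> verts G"
  shows "walks G (k + l) u v = (\<Sum>w\<in>verts G. walks G k u w * walks G l w v)"
  using assms(2)
proof (induction l arbitrary: v)
  case 0
  then show ?case using assms(1)
    by (simp add: sum.delta if_distrib[of "\<lambda>x. _ * x"] cong: if_cong)
next
  case (Suc l)
  have "walks G (k + Suc l) u v = (\<Sum>x\<in>verts G. \<Sum>w\<in>verts G. walks G k u w * walks G l w x * adj G x v)"
    by (simp add: Suc.IH sum_distrib_right)
  also have "\<dots> = (\<Sum>w\<in>verts G. \<Sum>x\<in>verts G. walks G k u w * walks G l w x * adj G x v)"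
    by (rule sum.swap)
  finally show ?case by (simp add: sum_distrib_left mult.assoc)
qed

lemma walks_commute:
  assumes "finite (verts G)" "u \<in> verts G" "v \<in> verts G"
  shows "walks G k u v = walks G k v u"
  using assms(2,3)
proof (induction k arbitrary: u v)
  case (Suc k)
  have "walks G (Suc k) v u = (\<Sum>w\<in>verts G. walks G (Suc 0) v w * walks G k w u)"
    using walks_add[OF assms(1) Suc.prems(1), of "Suc 0" k v] by (simp del: walks.simps(2))
  also have "\<dots> = (\<Sum>w\<in>verts G. walks G k u w * adj G w v)"
    using Suc by (intro sum.cong) (auto simp: walks_Suc_0[OF assms(1)] adj_commute mult.commute simp del: walks.simps(2))
  finally show ?case by simp
qed auto

lemma walks_double_diag:
  assumes "finite (verts G)" "u \<in> verts G"
  shows "walks G (2 * k) u u = (\<Sum>v\<in>verts G. (walks G k u v)\<^sup>2)"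
  unfolding mult_2 walks_add[OF assms] power2_eq_square
  using walks_commute[OF assms(1)] assms(2) by (intro sum.cong) auto

text \<open>Let \<open>q k\<close> be the quadratic form of the k-th power of the adjacency matrix
  at \<open>x\<close>. If its absolute value at 1 were at least \<open>2 * N\<close>, it would be at
  least \<open>N * 2 ^ k\<close> whenever k is a power of two, more than a trace bound of order
  \<open>r ^ k\<close> allows.\<close>

lemma quadratic_form_less:
  fixes c r :: real and x :: "'a \<Rightarrow> real"
  assumes fin: "finite (verts G)"
    and r: "0 \<le> r" "r < 2" and tr: "\<And>k. (\<Sum>u\<in>verts G. walks G k u u) \<le> c * r ^ k"
    and pos: "(\<Sum>u\<in>verts G. (x u)\<^sup>2) > 0"
  shows "\<bar>\<Sum>u\<in>verts G. \<Sum>v\<in>verts G. x u * adj G u v * x v\<bar> < 2 * (\<Sum>u\<in>verts G. (x u)\<^sup>2)"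
proof (rule ccontr)
  assume neg: "\<not> ?thesis"
  define N where "N = (\<Sum>u\<in>verts G. (x u)\<^sup>2)"
  define y where "y k u = (\<Sum>v\<in>verts G. walks G k u v * x v)" for k u
  define q where "q k = (\<Sum>u\<in>verts G. x u * y k u)" for k
  have N: "N > 0" using pos by (simp add: N_def)
  \<comment> \<open>By symmetry of the walk counts, the form of an even power is the squared norm of
    \<open>y k\<close>.\<close>
  have q_double: "q (2 * k) = (\<Sum>u\<in>verts G. (y k u)\<^sup>2)" for k
  proof -
    have "q (2 * k) = (\<Sum>u\<in>verts G. \<Sum>v\<in>verts G. \<Sum>w\<in>verts G. (walks G k w u * x u) * (walks G k w v * x v))"
      unfolding q_def y_def sum_distrib_left mult_2 using walks_commute[OF fin]
      by (intro sum.cong refl) (simp add: walks_add[OF fin] sum_distrib_left sum_distrib_right mult_ac)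
    also have "\<dots> = (\<Sum>u\<in>verts G. \<Sum>w\<in>verts G. \<Sum>v\<in>verts G. (walks G k w u * x u) * (walks G k w v * x v))"
      by (intro sum.cong refl sum.swap)
    also have "\<dots> = (\<Sum>w\<in>verts G. \<Sum>u\<in>verts G. \<Sum>v\<in>verts G. (walks G k w u * x u) * (walks G k w v * x v))"
      by (rule sum.swap)
    finally show ?thesis by (simp add: y_def power2_eq_square sum_product)
  qed
  have cs1: "(q k)\<^sup>2 \<le> N * q (2 * k)" for k
    unfolding q_double N_def unfolding q_def by (rule Cauchy_Schwarz_sum)
  \<comment> \<open>Cauchy-Schwarz in each row; the squared entries of the k-th power add up to the
    trace of the 2k-th power.\<close>
  have cs2: "q (2 * k) \<le> N * (c * r ^ (2 * k))" for k
  proof -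
    have "q (2 * k) \<le> (\<Sum>u\<in>verts G. (\<Sum>v\<in>verts G. (walks G k u v)\<^sup>2) * N)"
      unfolding q_double N_def y_def by (intro sum_mono Cauchy_Schwarz_sum)
    also have "\<dots> = (\<Sum>u\<in>verts G. walks G (2 * k) u u) * N"
      by (simp add: sum_distrib_right walks_double_diag[OF fin])
    also have "\<dots> \<le> c * r ^ (2 * k) * N"
      using tr N by (intro mult_right_mono) auto
    finally show ?thesis by (simp add: mult_ac)
  qed
  \<comment> \<open>Each use of \<open>cs1\<close> doubles the exponent; the base case is the
    negated claim.\<close>
  have low: "N * 2 ^ (2 ^ k) \<le> \<bar>q (2 ^ k)\<bar>" for k
  proof (induction k)
    case 0
    have "q (Suc 0) = (\<Sum>u\<in>verts G. \<Sum>v\<in>verts G. x u * adj G u v * x v)"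
      unfolding q_def y_def sum_distrib_left
      by (intro sum.cong refl) (simp add: walks_Suc_0[OF fin] mult_ac del: walks.simps)
    thus ?case using neg by (simp add: N_def)
  next
    case (Suc k)
    have "N * (N * 2 ^ (2 ^ Suc k)) = (N * 2 ^ (2 ^ k))\<^sup>2"
      by (simp add: power2_eq_square power_add mult_2 mult_ac)
    also have "\<dots> \<le> \<bar>q (2 ^ k)\<bar>\<^sup>2"
      using Suc N by (intro power_mono) auto
    also have "\<dots> \<le> N * q (2 ^ Suc k)" using cs1[of "2 ^ k"] by simp
    finally show ?case using N by (simp add: mult_le_cancel_left_pos)
  qed
  have "c \<ge> 0" using tr[of 0] by simp
  \<comment> \<open>Since \<open>M = 2 * 2 ^ m\<close> is at least \<open>m\<close>, this choice
    makes \<open>c * (r / 2) ^ M\<close> less than 1, whereas the two bounds on \<open>q M\<close>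
    force it to be at least 1. The denominator \<open>c + 1\<close> is positive even for
    \<open>c = 0\<close>.\<close>
  obtain m where m: "(r / 2) ^ m < 1 / (c + 1)"
    using real_arch_pow_inv[of "1 / (c + 1)" "r / 2"] r \<open>c \<ge> 0\<close> by auto
  define M :: nat where "M = 2 * 2 ^ m"
  have "m \<le> M" unfolding M_def using less_exp[of m] by linarith
  have "N * 2 ^ M \<le> \<bar>q M\<bar>" using low[of "Suc m"] unfolding M_def power_Suc .
  moreover have "0 \<le> N * q M"
    using cs1[of "2 ^ m"] zero_le_power2 order_trans unfolding M_def by blast
  hence "0 \<le> q M" using N by (simp add: zero_le_mult_iff)
  moreover have "q M \<le> N * (c * r ^ M)" unfolding M_def by (rule cs2)
  ultimately have "N * 2 ^ M \<le> N * (c * r ^ M)" by linarith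
  hence "2 ^ M \<le> c * r ^ M" using N by (simp add: mult_le_cancel_left_pos)
  hence "1 \<le> c * (r / 2) ^ M" by (simp add: power_divide)
  also have "\<dots> \<le> c * (r / 2) ^ m"
    using r \<open>c \<ge> 0\<close> \<open>m \<le> M\<close> by (intro mult_left_mono power_decreasing) auto
  also have "\<dots> \<le> c * (1 / (c + 1))" using m \<open>c \<ge> 0\<close> by (intro mult_left_mono) auto
  also have "\<dots> < 1" using \<open>c \<ge> 0\<close> by simp
  finally show False by simp
qed

text \<open>Extension of \<open>x\<close> by zero outside \<open>S\<close> carries the bound over to
  induced subgraphs.\<close>

lemma quadratic_form_less_on:
  fixes c r :: real and x :: "'a \<Rightarrow> real"
  assumes fin: "finite (verts G)"
    and r: "0 \<le> r" "r < 2" and tr: "\<And>k. (\<Sum>u\<in>verts G. walks G k u u) \<le> c * r ^ k"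
    and S: "S \<subseteq> verts G" and pos: "(\<Sum>u\<in>S. (x u)\<^sup>2) > 0"
  shows "\<bar>\<Sum>u\<in>S. \<Sum>v\<in>S. x u * adj G u v * x v\<bar> < 2 * (\<Sum>u\<in>S. (x u)\<^sup>2)"
proof -
  define z where "z u = (if u \<in> S then x u else 0)" for u
  have "(\<Sum>u\<in>verts G. (z u)\<^sup>2) = (\<Sum>u\<in>S. (x u)\<^sup>2)"
    using fin S by (intro sum.mono_neutral_cong_right) (auto simp: z_def)
  moreover have "(\<Sum>v\<in>verts G. z u * adj G u v * z v) = (\<Sum>v\<in>S. z u * adj G u v * x v)" for u
    using fin S by (intro sum.mono_neutral_cong_right) (auto simp: z_def)
  moreover have "(\<Sum>u\<in>verts G. \<Sum>v\<in>S. z u * adj G u v * x v) = (\<Sum>u\<in>S. \<Sum>v\<in>S. x u * adj G u v * x v)"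
    using fin S by (intro sum.mono_neutral_cong_right) (auto simp: z_def intro: finite_subset)
  ultimately show ?thesis
    using quadratic_form_less[OF fin r tr, of z] pos by simp
qed

text \<open>A Perron-type argument: the k-th power maps the positive eigenvector \<open>s\<close> to
  \<open>r ^ k\<close> times itself, and since all terms are nonnegative, the diagonal term
  \<open>walks G k u u * s u\<close> alone is at most \<open>r ^ k * s u\<close>.\<close>

lemma sum_walks_diag_le:
  assumes fin: "finite (verts G)"
    and nn: "\<And>u v. u \<in> verts G \<Longrightarrow> v \<in> verts G \<Longrightarrow> adj G u v \<ge> 0"
    and s: "\<And>u. u \<in> verts G \<Longrightarrow> s u > 0" and ev: "eigenfun G r s"
  shows "(\<Sum>u\<in>verts G. walks G k u u) \<le> real (card (verts G)) * r ^ k"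
proof -
  have w: "walks G k u v \<ge> 0" if "u \<in> verts G" "v \<in> verts G" for k u v
    using that nn by (induction k arbitrary: v) (auto intro!: sum_nonneg)
  have e: "(\<Sum>v\<in>verts G. walks G k u v * s v) = r ^ k * s u" if u: "u \<in> verts G" for k u
  proof (induction k)
    case 0
    then show ?case using fin u by (simp add: sum.delta if_distrib[of "\<lambda>x. x * _"] cong: if_cong)
  next
    case (Suc k)
    have "(\<Sum>v\<in>verts G. walks G (Suc k) u v * s v)
        = (\<Sum>v\<in>verts G. \<Sum>w\<in>verts G. walks G k u w * adj G w v * s v)"
      by (simp add: sum_distrib_right)
    also have "\<dots> = (\<Sum>w\<in>verts G. \<Sum>v\<in>verts G. walks G k u w * adj G w v * s v)"
      by (rule sum.swap)
    also have "\<dots> = (\<Sum>w\<in>verts G. walks G k u w * (\<Sum>v\<in>verts G. adj G w v * s v))"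
      by (simp add: sum_distrib_left mult.assoc)
    also have "\<dots> = (\<Sum>w\<in>verts G. r * (walks G k u w * s w))"
      using ev by (intro sum.cong) (auto simp: eigenfun_def)
    finally show ?case by (simp flip: sum_distrib_left add: Suc)
  qed
  have "walks G k u u \<le> r ^ k" if u: "u \<in> verts G" for u
  proof -
    have "walks G k u u * s u \<le> (\<Sum>v\<in>verts G. walks G k u v * s v)"
      using member_le_sum[of u "verts G" "\<lambda>v. walks G k u v * s v"] fin u w s
      by (simp add: less_imp_le)
    thus ?thesis using e[OF u] s[OF u] by simp
  qed
  thus ?thesis using sum_bounded_above[of "verts G" "\<lambda>u. walks G k u u" "r ^ k"] by simp
qed

section \<open>Degrees and closed walks\<close>

definition nbrs :: "'a sgraph \<Rightarrow> 'a \<Rightarrow> 'a set" where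
  "nbrs G u = {w. {u, w} \<in> edges G}"

lemma nbrs_commute: "w \<in> nbrs G u \<longleftrightarrow> u \<in> nbrs G w"
  by (simp add: nbrs_def insert_commute)

lemma nbrs_subset: "signed_graph G \<Longrightarrow> nbrs G u \<subseteq> verts G"
  by (auto simp: nbrs_def signed_graph_def)

lemma nbrs_in_verts: "signed_graph G \<Longrightarrow> w \<in> nbrs G u \<Longrightarrow> u \<in> verts G \<and> w \<in> verts G"
  by (auto simp: nbrs_def signed_graph_def)

lemma not_in_nbrs_self: "signed_graph G \<Longrightarrow> u \<notin> nbrs G u"
  by (force simp: nbrs_def signed_graph_def)

lemma finite_nbrs: "signed_graph G \<Longrightarrow> finite (nbrs G u)"
  using nbrs_subset finite_subset by (metis signed_graph_def)

lemma adj_nbrs_square: "signed_graph G \<Longrightarrow> (adj G u v)\<^sup>2 = (if v \<in> nbrs G u then 1 else 0)"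
  by (simp add: adj_square nbrs_def)

lemma adj_nbrs_cases: "signed_graph G \<Longrightarrow> v \<in> nbrs G u \<Longrightarrow> adj G u v = 1 \<or> adj G u v = -1"
  using adj_nbrs_square[of G u v] by (simp add: power2_eq_1_iff)

lemma sum_adj_mult:
  assumes "signed_graph G"
  shows "(\<Sum>w\<in>verts G. adj G u w * f w) = (\<Sum>w\<in>nbrs G u. adj G u w * f w)"
  using assms nbrs_subset[OF assms]
  by (intro sum.mono_neutral_right) (auto simp: nbrs_def adj_def signed_graph_def)

lemma sum_adj_square:
  assumes "signed_graph G"
  shows "(\<Sum>w\<in>verts G. (adj G u w)\<^sup>2) = real (card (nbrs G u))"
  using assms nbrs_subset[OF assms, of u]
  by (simp add: adj_nbrs_square sum.If_cases signed_graph_def Int_absorb1)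

lemma sum_walks_2:
  assumes "signed_graph G"
  shows "(\<Sum>u\<in>verts G. walks G 2 u u) = (\<Sum>u\<in>verts G. real (card (nbrs G u)))"
proof (rule sum.cong[OF refl])
  fix u assume u: "u \<in> verts G"
  have fin: "finite (verts G)" using assms by (simp add: signed_graph_def)
  have "walks G 2 u u = (\<Sum>v\<in>verts G. (walks G (Suc 0) u v)\<^sup>2)"
    using walks_double_diag[OF fin u, of "Suc 0"] by (simp add: numeral_2_eq_2 del: walks.simps)
  thus "walks G 2 u u = real (card (nbrs G u))"
    by (simp add: walks_Suc_0[OF fin u] sum_adj_square[OF assms] del: walks.simps)
qed

text \<open>A single nonzero term produces no mixed products. In the application the terms are the
  signed walks of length two between distinct vertices, and squaring erases their signs.\<close>

lemma sum_square_card_le_1: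
  fixes f :: "'b \<Rightarrow> real"
  assumes "finite A" "card {w \<in> A. f w \<noteq> 0} \<le> 1"
  shows "(\<Sum>w\<in>A. f w)\<^sup>2 = (\<Sum>w\<in>A. (f w)\<^sup>2)"
proof -
  let ?B = "{w \<in> A. f w \<noteq> 0}"
  have e: "(\<Sum>w\<in>A. f w) = (\<Sum>w\<in>?B. f w)" "(\<Sum>w\<in>A. (f w)\<^sup>2) = (\<Sum>w\<in>?B. (f w)\<^sup>2)"
    using assms(1) by (auto intro!: sum.mono_neutral_right)
  have "card ?B = 0 \<or> card ?B = 1" using assms(2) by linarith
  moreover have "finite ?B" using assms(1) by simp
  ultimately have "?B = {} \<or> (\<exists>a. ?B = {a})" by (auto simp: card_1_singleton_iff)
  thus ?thesis unfolding e by (elim disjE exE) (simp_all only: sum.empty, auto)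
qed

text \<open>The trace of the fourth power is the sum of the squared entries of the square. Off the
  diagonal these squares forget the signs, and the signless sum over all walks u, w, v is the sum of
  the squared degrees of the middle vertices w.\<close>

lemma sum_walks_4:
  assumes G: "signed_graph G"
    and one: "\<And>u v. u \<in> verts G \<Longrightarrow> v \<in> verts G \<Longrightarrow> u \<noteq> v \<Longrightarrow> card (nbrs G u \<inter> nbrs G v) \<le> 1"
  shows "(\<Sum>u\<in>verts G. walks G 4 u u)
    = (\<Sum>u\<in>verts G. 2 * (real (card (nbrs G u)))\<^sup>2 - real (card (nbrs G u)))"
proof -
  let ?V = "verts G" and ?d = "\<lambda>u. real (card (nbrs G u))" and ?b = "\<lambda>u v. (adj G u v)\<^sup>2"
  have fin: "finite ?V" using G by (simp add: signed_graph_def)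
  have w2: "walks G 2 u v = (\<Sum>w\<in>?V. adj G u w * adj G w v)" if "u \<in> ?V" for u v
    by (simp only: numeral_2_eq_2 walks.simps(2)[of G "Suc 0"] walks_Suc_0[OF fin that])
  \<comment> \<open>On the diagonal the signless sum yields the degree d where the squared entry is
    \<open>d\<^sup>2\<close>; the last summand corrects this.\<close>
  have sq: "(walks G 2 u v)\<^sup>2 = (\<Sum>w\<in>?V. ?b u w * ?b w v) + (if u = v then (?d u)\<^sup>2 - ?d u else 0)"
    if u: "u \<in> ?V" and v: "v \<in> ?V" for u v
  proof (cases "u = v")
    case True
    have "walks G 2 u u = ?d u"
      using w2[OF u] sum_adj_square[OF G, of u]
      by (simp add: power2_eq_square adj_commute[of G _ u])
    moreover have "?b u w * ?b w u = ?b u w" for w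
      by (simp add: adj_commute[of G w u] adj_nbrs_square[OF G])
    hence "(\<Sum>w\<in>?V. ?b u w * ?b w u) = ?d u"
      by (simp only: sum_adj_square[OF G])
    ultimately show ?thesis using True by simp
  next
    case False
    have "{w \<in> ?V. adj G u w * adj G w v \<noteq> 0} \<subseteq> nbrs G u \<inter> nbrs G v"
      by (auto simp: adj_def nbrs_def insert_commute split: if_splits)
    hence "card {w \<in> ?V. adj G u w * adj G w v \<noteq> 0} \<le> 1"
      using card_mono[of "nbrs G u \<inter> nbrs G v"] finite_nbrs[OF G, of u] one[OF u v False]
      by (meson finite_Int le_trans)
    thus ?thesis using False
      by (simp add: w2[OF u] sum_square_card_le_1[OF fin] power_mult_distrib)
  qed
  have "(\<Sum>u\<in>?V. walks G 4 u u) = (\<Sum>u\<in>?V. \<Sum>v\<in>?V. (walks G 2 u v)\<^sup>2)"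
    using walks_double_diag[OF fin, of _ 2] by simp
  also have "\<dots> = (\<Sum>u\<in>?V. (\<Sum>v\<in>?V. \<Sum>w\<in>?V. ?b u w * ?b w v) + ((?d u)\<^sup>2 - ?d u))"
    using fin by (intro sum.cong refl) (simp add: sq sum.distrib sum.delta cong: sum.cong)
  also have "\<dots> = (\<Sum>u\<in>?V. \<Sum>v\<in>?V. \<Sum>w\<in>?V. ?b u w * ?b w v) + (\<Sum>u\<in>?V. (?d u)\<^sup>2 - ?d u)"
    by (rule sum.distrib)
  also have "(\<Sum>u\<in>?V. \<Sum>v\<in>?V. \<Sum>w\<in>?V. ?b u w * ?b w v) = (\<Sum>u\<in>?V. \<Sum>w\<in>?V. \<Sum>v\<in>?V. ?b u w * ?b w v)"
    by (intro sum.cong refl sum.swap)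
  also have "\<dots> = (\<Sum>w\<in>?V. \<Sum>u\<in>?V. \<Sum>v\<in>?V. ?b u w * ?b w v)"
    by (rule sum.swap)
  also have "\<dots> = (\<Sum>w\<in>?V. (\<Sum>u\<in>?V. ?b w u) * (\<Sum>v\<in>?V. ?b w v))"
    by (simp add: sum_product adj_commute)
  also have "\<dots> = (\<Sum>w\<in>?V. (?d w)\<^sup>2)"
    unfolding sum_adj_square[OF G] by (simp add: power2_eq_square)
  finally show ?thesis by (simp add: sum.distrib[symmetric] algebra_simps)
qed

section \<open>The path: degrees, positive eigenvector and common neighbours\<close>

lemma nbrs_path_graph:
  "i < n \<Longrightarrow> nbrs (path_graph n) i = (if 0 < i then {i - 1} else {}) \<union> (if Suc i < n then {Suc i} else {})"
  by (cases i) (auto simp: nbrs_def path_graph_def doubleton_eq_iff)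

lemma verts_path_graph: "verts (path_graph n) = {..<n}"
  by (simp add: path_graph_def)

lemma card_nbrs_path_graph:
  "i < n \<Longrightarrow> card (nbrs (path_graph n) i) = (if 0 < i then 1 else 0) + (if Suc i < n then 1 else 0)"
  by (auto simp: nbrs_path_graph)

text \<open>Left and right neighbours are counted separately. Each kind is missing at exactly one
  vertex, also when both ends coincide for \<open>n = 1\<close>.\<close>

lemma sum_card_nbrs_path_graph:
  assumes "n \<ge> 1"
  shows "(\<Sum>i<n. real (card (nbrs (path_graph n) i))) = 2 * real n - 2"
proof -
  have "(\<Sum>i<n. real (card (nbrs (path_graph n) i)))
      = (\<Sum>i<n. if i = 0 then 0 else 1) + (\<Sum>i<n. if i = n - 1 then 0 else 1)"
    unfolding sum.distrib[symmetric] by (intro sum.cong refl) (auto simp: card_nbrs_path_graph)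
  moreover have "(\<Sum>i<n. if i = k then 0 else 1) = real n - 1" if "k < n" for k
  proof -
    have "(\<Sum>i<n. if i = k then 0 else 1 :: real) = (\<Sum>i<n. 1 - (if i = k then 1 else 0))"
      by (intro sum.cong) auto
    thus ?thesis using that by (simp add: sum_subtractf)
  qed
  ultimately show ?thesis using assms by simp
qed

text \<open>The eigenvalue equation is the addition formula for
  \<open>sin (x - t) + sin (x + t)\<close>. The sequence \<open>sin (j * t)\<close> vanishes at j =
  0 and j = n + 1, so the missing neighbours of the ends contribute nothing; in between its
  arguments lie strictly between 0 and pi. Vertices start at 0, whence the shift by one.\<close>

lemma eigenfun_path_graph:
  fixes n :: nat
  assumes "n \<ge> 1"
  defines "t \<equiv> pi / (real n + 1)"
  shows "eigenfun (path_graph n) (2 * cos t) (\<lambda>i. sin ((real i + 1) * t))"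
    and "i < n \<Longrightarrow> sin ((real i + 1) * t) > 0"
proof -
  have pos: "sin ((real i + 1) * t) > 0" if "i < n" for i
  proof (rule sin_gt_zero)
    show "0 < (real i + 1) * t" by (simp add: t_def add_nonneg_pos)
    have "(real i + 1) * pi < (real n + 1) * pi" using that by (intro mult_strict_right_mono) auto
    thus "(real i + 1) * t < pi" by (simp add: t_def field_simps)
  qed
  have sin_sum: "sin (x - y) + sin (x + y) = 2 * cos y * sin x" for x y :: real
    by (simp add: sin_add sin_diff)
  have adj1: "adj (path_graph n) i j = 1" if "j \<in> nbrs (path_graph n) i" for i j
    using that by (simp add: adj_def nbrs_def) (simp add: path_graph_def)
  have "(\<Sum>w\<in>verts (path_graph n). adj (path_graph n) i w * sin ((real w + 1) * t))
      = 2 * cos t * sin ((real i + 1) * t)" if i: "i < n" for i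
  proof -
    have last: "sin ((real n + 1) * t) = 0" by (simp add: t_def)
    have "(\<Sum>w\<in>verts (path_graph n). adj (path_graph n) i w * sin ((real w + 1) * t))
        = (\<Sum>w\<in>nbrs (path_graph n) i. sin ((real w + 1) * t))"
      unfolding sum_adj_mult[OF signed_graph_path_graph] by (intro sum.cong refl) (simp add: adj1)
    also have "\<dots> = sin (real i * t) + sin ((real i + 2) * t)"
    proof (cases "Suc i < n")
      case True
      thus ?thesis using i by (cases "i = 0") (auto simp: nbrs_path_graph add_ac)
    next
      case False
      hence n: "n = Suc i" using i by simp
      have "sin ((real i + 2) * t) = 0" using last by (simp add: n add_ac)
      thus ?thesis using i False by (cases "i = 0") (auto simp: nbrs_path_graph add_ac)
    qed
    also have "\<dots> = sin ((real i + 1) * t - t) + sin ((real i + 1) * t + t)"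
      by (simp add: algebra_simps)
    also have "\<dots> = 2 * cos t * sin ((real i + 1) * t)"
      by (rule sin_sum)
    finally show ?thesis .
  qed
  thus "eigenfun (path_graph n) (2 * cos t) (\<lambda>i. sin ((real i + 1) * t))"
    using assms(1) pos[of 0] by (auto simp: eigenfun_def verts_path_graph intro!: bexI[of _ 0])
  show "i < n \<Longrightarrow> sin ((real i + 1) * t) > 0" by (rule pos)
qed

lemma card_common_nbrs_path_graph:
  assumes "i < n" "j < n" "i \<noteq> j"
  shows "card (nbrs (path_graph n) i \<inter> nbrs (path_graph n) j) \<le> 1"
proof -
  have "a = b" if "a \<in> nbrs (path_graph n) i \<inter> nbrs (path_graph n) j"
    "b \<in> nbrs (path_graph n) i \<inter> nbrs (path_graph n) j" for a b
    using that assms by (auto simp: nbrs_path_graph split: if_splits)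
  thus ?thesis using finite_nbrs[OF signed_graph_path_graph] by (simp add: card_le_Suc0_iff_eq)
qed

section \<open>Triangles and chordless quadrangles under the bound on the quadratic form\<close>

lemma no_triangle:
  assumes G: "signed_graph G"
    and Q: "\<And>S x. S \<subseteq> verts G \<Longrightarrow> (\<Sum>u\<in>S. (x u)\<^sup>2) > 0 \<Longrightarrow>
      \<bar>\<Sum>u\<in>S. \<Sum>v\<in>S. x u * adj G u v * x v\<bar> < 2 * (\<Sum>u\<in>S. (x u)\<^sup>2)"
    and b: "b \<in> nbrs G a" and c: "c \<in> nbrs G a" and bc: "c \<in> nbrs G b"
  shows False
proof -
  let ?p = "adj G a b" and ?q = "adj G a c" and ?r = "adj G b c"
  \<comment> \<open>With these values each of the three edges contributes
    \<open>2 * (?p * ?q * ?r)\<close> to the form. Its absolute value is therefore 6, twice the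
    squared norm 3, whatever the balance of the triangle.\<close>
  define x where "x v = (if v = a then 1 else if v = b then ?q * ?r else ?p * ?r)" for v
  have ne: "a \<noteq> b" "a \<noteq> c" "b \<noteq> c" using not_in_nbrs_self[OF G] b c bc by auto
  have S: "{a, b, c} \<subseteq> verts G" using nbrs_in_verts[OF G] b c by blast
  have "?p = 1 \<or> ?p = -1" "?q = 1 \<or> ?q = -1" "?r = 1 \<or> ?r = -1"
    using adj_nbrs_cases[OF G] b c bc by auto
  thus False
    using Q[OF S, of x] ne
    by (auto simp: x_def adj_self[OF G] adj_commute[of G b a] adj_commute[of G c a] adj_commute[of G c b])
qed

lemma induced_quadrangle_unbalanced:
  assumes G: "signed_graph G"
    and Q: "\<And>S x. S \<subseteq> verts G \<Longrightarrow> (\<Sum>u\<in>S. (x u)\<^sup>2) > 0 \<Longrightarrow>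
      \<bar>\<Sum>u\<in>S. \<Sum>v\<in>S. x u * adj G u v * x v\<bar> < 2 * (\<Sum>u\<in>S. (x u)\<^sup>2)"
    and e: "b \<in> nbrs G a" "c \<in> nbrs G b" "d \<in> nbrs G c" "a \<in> nbrs G d"
    and ne: "a \<noteq> c" "b \<noteq> d" and nc: "c \<notin> nbrs G a" "d \<notin> nbrs G b"
  shows "adj G a b * adj G b c * adj G c d * adj G d a = -1"
proof (rule ccontr)
  assume bal: "\<not> ?thesis"
  let ?p = "adj G a b" and ?q = "adj G b c" and ?r = "adj G c d" and ?s = "adj G d a"
  \<comment> \<open>These values switch a balanced quadrangle to all-positive signs: each edge
    contributes 2, and without chords the form is 8, twice the squared norm 4. The last edge
    contributes 2 precisely because the sign product is 1.\<close>
  define x where "x v = (if v = a then 1 else if v = b then ?p else if v = c then ?p * ?q else ?s)" for v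
  have ne': "a \<noteq> b" "a \<noteq> d" "b \<noteq> c" "c \<noteq> d" using not_in_nbrs_self[OF G] e by auto
  have S: "{a, b, c, d} \<subseteq> verts G" using nbrs_in_verts[OF G] e by blast
  have z: "adj G a c = 0" "adj G b d = 0" using nc by (auto simp: adj_def nbrs_def)
  have "?p = 1 \<or> ?p = -1" "?q = 1 \<or> ?q = -1" "?r = 1 \<or> ?r = -1" "?s = 1 \<or> ?s = -1"
    using adj_nbrs_cases[OF G] e by auto
  thus False
    using Q[OF S, of x] ne ne' z bal
    by (auto simp: x_def adj_self[OF G] adj_commute[of G b a] adj_commute[of G c a]
        adj_commute[of G c b] adj_commute[of G d b] adj_commute[of G d c] adj_commute[of G a d])
qed

section \<open>Eigenfunctions along paths and cycles\<close>

text \<open>Each step of the recurrence rotates the pair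
  \<open>(sin t * g i, g (Suc i) - cos t * g i)\<close> by the angle \<open>t\<close>, starting from
  \<open>(d, c)\<close>. The factor \<open>sin t\<close> avoids a division.\<close>

lemma rotation_recurrence:
  fixes g :: "nat \<Rightarrow> real" and t :: real
  assumes rec: "\<And>i. i < m \<Longrightarrow> g (Suc (Suc i)) = 2 * cos t * g (Suc i) - g i"
  defines "c \<equiv> g 1 - cos t * g 0" and "d \<equiv> sin t * g 0"
  shows "i \<le> m \<Longrightarrow> sin t * g i = c * sin (real i * t) + d * cos (real i * t) \<and>
    g (Suc i) - cos t * g i = c * cos (real i * t) - d * sin (real i * t)"
proof (induction i)
  case 0
  show ?case by (simp add: c_def d_def)
next
  case (Suc i)
  let ?C = "cos (real i * t)" and ?S = "sin (real i * t)"
  have t: "real (Suc i) * t = real i * t + t" by (simp add: algebra_simps)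
  have IH: "sin t * g i = c * ?S + d * ?C" "g (Suc i) - cos t * g i = c * ?C - d * ?S"
    using Suc by auto
  have "sin t * g (Suc i) = sin t * (g (Suc i) - cos t * g i) + cos t * (sin t * g i)"
    by (simp add: algebra_simps)
  also have "\<dots> = c * sin (real i * t + t) + d * cos (real i * t + t)"
    unfolding IH sin_add cos_add by (simp add: algebra_simps)
  finally have 1: "sin t * g (Suc i) = c * sin (real i * t + t) + d * cos (real i * t + t)" .
  have "g (Suc (Suc i)) - cos t * g (Suc i) = cos t * g (Suc i) - g i"
    using rec[of i] Suc.prems by simp
  also have "\<dots> = cos t * (g (Suc i) - cos t * g i) - (1 - (cos t)\<^sup>2) * g i"
    by (simp add: algebra_simps power2_eq_square)
  also have "1 - (cos t)\<^sup>2 = sin t * sin t"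
    by (metis sin_squared_eq power2_eq_square)
  also have "cos t * (g (Suc i) - cos t * g i) - sin t * sin t * g i
      = cos t * (g (Suc i) - cos t * g i) - sin t * (sin t * g i)" by simp
  also have "\<dots> = c * cos (real i * t + t) - d * sin (real i * t + t)"
    unfolding IH sin_add cos_add by (simp add: algebra_simps)
  finally show ?case using 1 t by simp
qed

text \<open>With \<open>g 0 = 0\<close> the solution is a multiple of \<open>sin (i * t)\<close>,
  and the zero at \<open>Suc m\<close> forces the factor \<open>g 1\<close> to vanish.\<close>

lemma dirichlet_recurrence_zero:
  fixes g :: "nat \<Rightarrow> real"
  assumes rec: "\<And>i. i < m \<Longrightarrow> g (Suc (Suc i)) = 2 * cos t * g (Suc i) - g i"
    and ends: "g 0 = 0" "g (Suc m) = 0"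
    and t: "sin t \<noteq> 0" "sin (real (Suc m) * t) \<noteq> 0" and i: "i \<le> m"
  shows "g i = 0"
proof -
  note R = rotation_recurrence[of m g t, OF rec]
  \<comment> \<open>The closed form is available only up to \<open>m\<close>; one more rotation by
    hand gives \<open>sin t * g (Suc m)\<close> on the left.\<close>
  have "cos t * (sin t * g m) + sin t * (g (Suc m) - cos t * g m) = g 1 * sin (real m * t + t)"
    using R[of m] ends(1) by (simp add: sin_add algebra_simps)
  moreover have "real (Suc m) * t = real m * t + t" by (simp add: algebra_simps)
  ultimately have "g 1 = 0" using ends(2) t(2) by (simp add: algebra_simps)
  thus ?thesis using R[OF _ i] ends t(1) by simp
qed

text \<open>Rotation by \<open>k * t\<close> multiplies the initial pair by the real number
  \<open>s\<close>. A rotation with nonzero sine has no real eigenvalue, so the pair is zero. The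
  factor \<open>s\<close> will be the sign of a cycle, which treats balanced and unbalanced cycles
  alike.\<close>

lemma quasiperiodic_recurrence_zero:
  fixes g :: "nat \<Rightarrow> real"
  assumes rec: "\<And>i. g (Suc (Suc i)) = 2 * cos t * g (Suc i) - g i"
    and per: "g k = s * g 0" "g (Suc k) = s * g 1"
    and t: "sin t \<noteq> 0" "sin (real k * t) \<noteq> 0"
  shows "g 0 = 0"
proof -
  define c where "c = g 1 - cos t * g 0"
  define d where "d = sin t * g 0"
  define C where "C = cos (real k * t)"
  define S where "S = sin (real k * t)"
  have "sin t * g k = c * S + d * C" "g (Suc k) - cos t * g k = c * C - d * S"
    using rotation_recurrence[of k g t k, OF rec] unfolding c_def d_def C_def S_def by auto
  hence e: "s * d = c * S + d * C" "s * c = c * C - d * S"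
    by (simp_all add: per c_def d_def algebra_simps)
  \<comment> \<open>The bracket is the determinant of the rotation matrix minus \<open>s\<close>
    times the identity.\<close>
  have "d * (S\<^sup>2 + (C - s)\<^sup>2) = S * (d * S) + (C - s) * (d * C - s * d)"
    by (simp add: power2_eq_square algebra_simps)
  also have "d * S = (C - s) * c" using e(2) by (simp add: algebra_simps)
  also have "d * C - s * d = - (c * S)" using e(1) by simp
  finally have "d * (S\<^sup>2 + (C - s)\<^sup>2) = 0" by (simp add: algebra_simps)
  moreover have "S \<noteq> 0" using t(2) by (simp add: S_def)
  ultimately show ?thesis using t(1) by (simp add: d_def)
qed

text \<open>Multiplying an eigenfunction along a walk by these partial sign products removes all signs
  from the eigenvalue equations.\<close>

definition sign_along :: "'a sgraph \<Rightarrow> (nat \<Rightarrow> 'a) \<Rightarrow> nat \<Rightarrow> real" where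
  "sign_along G y i = (\<Prod>l<i. adj G (y l) (y (Suc l)))"

lemma sign_along_simps [simp]:
  "sign_along G y 0 = 1"
  "sign_along G y (Suc i) = sign_along G y i * adj G (y i) (y (Suc i))"
  by (simp_all add: sign_along_def)

lemma sign_along_cases:
  assumes "signed_graph G" "\<And>l. l < i \<Longrightarrow> y (Suc l) \<in> nbrs G (y l)"
  shows "sign_along G y i = 1 \<or> sign_along G y i = -1"
  using assms(2)
proof (induction i)
  case (Suc i)
  have "sign_along G y i = 1 \<or> sign_along G y i = -1" using Suc by simp
  moreover have "adj G (y i) (y (Suc i)) = 1 \<or> adj G (y i) (y (Suc i)) = -1"
    using adj_nbrs_cases[OF assms(1)] Suc.prems[of i] by simp
  ultimately show ?case by auto
qed simp

lemma eigenfun_eq: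
  assumes "signed_graph G" "eigenfun G r f" "u \<in> verts G"
  shows "(\<Sum>w\<in>nbrs G u. adj G u w * f w) = r * f u"
  using assms sum_adj_mult[OF assms(1), of u f] by (simp add: eigenfun_def)

lemma sign_along_step_back:
  assumes "signed_graph G" "y (Suc i) \<in> nbrs G (y i)"
  shows "sign_along G y (Suc i) * adj G (y (Suc i)) (y i) = sign_along G y i"
  using adj_nbrs_cases[OF assms] by (auto simp: adj_commute[of G "y (Suc i)" "y i"])

lemma eigenfun_recurrence:
  assumes G: "signed_graph G" and ev: "eigenfun G r f"
    and N: "nbrs G (y (Suc i)) = {y i, y (Suc (Suc i))}" and ne: "y i \<noteq> y (Suc (Suc i))"
  shows "sign_along G y (Suc (Suc i)) * f (y (Suc (Suc i)))
    = r * (sign_along G y (Suc i) * f (y (Suc i))) - sign_along G y i * f (y i)"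
proof -
  have m: "y (Suc i) \<in> nbrs G (y i)" using N nbrs_commute by fastforce
  have V: "y (Suc i) \<in> verts G" using m nbrs_in_verts[OF G] by blast
  have "adj G (y (Suc i)) (y i) * f (y i) + adj G (y (Suc i)) (y (Suc (Suc i))) * f (y (Suc (Suc i)))
      = r * f (y (Suc i))"
    using eigenfun_eq[OF G ev V] ne unfolding N by simp
  hence "sign_along G y (Suc i) * adj G (y (Suc i)) (y i) * f (y i)
      + sign_along G y (Suc i) * adj G (y (Suc i)) (y (Suc (Suc i))) * f (y (Suc (Suc i)))
      = r * (sign_along G y (Suc i) * f (y (Suc i)))"
    by (metis (no_types, opaque_lifting) distrib_left mult.assoc mult.left_commute)
  thus ?thesis
    unfolding sign_along_step_back[of G y i, OF G m] sign_along_simps(2)[of G y "Suc i"] by linarith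
qed

section \<open>Maximal paths in graphs with degrees at most two\<close>

definition path_in :: "'a sgraph \<Rightarrow> 'a list \<Rightarrow> bool" where
  "path_in G xs \<longleftrightarrow> distinct xs \<and> set xs \<subseteq> verts G \<and>
     (\<forall>i. Suc i < length xs \<longrightarrow> xs ! Suc i \<in> nbrs G (xs ! i))"

text \<open>A longest path from \<open>s\<close> exists because distinctness bounds its length; a
  neighbour of its last vertex off the path could be appended.\<close>

lemma ex_maximal_path:
  assumes G: "signed_graph G" and s: "s \<in> verts G"
  obtains xs where "path_in G xs" "xs \<noteq> []" "xs ! 0 = s" "nbrs G (last xs) \<subseteq> set xs"
proof -
  let ?P = "\<lambda>xs. path_in G xs \<and> xs \<noteq> [] \<and> xs ! 0 = s"
  have fin: "finite (verts G)" using G by (simp add: signed_graph_def)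
  have "?P [s]" using s by (simp add: path_in_def)
  moreover have "\<forall>xs. ?P xs \<longrightarrow> length xs < Suc (card (verts G))"
  proof (intro allI impI)
    fix xs assume xs: "?P xs"
    hence "card (set xs) \<le> card (verts G)" by (intro card_mono fin) (simp add: path_in_def)
    thus "length xs < Suc (card (verts G))" using xs distinct_card[of xs] by (simp add: path_in_def)
  qed
  ultimately obtain xs where xs: "?P xs" and max: "\<And>ys. ?P ys \<Longrightarrow> length ys \<le> length xs"
    using ex_has_greatest_nat[of ?P "[s]" length] by blast
  have "w \<in> set xs" if w: "w \<in> nbrs G (last xs)" for w
  proof (rule ccontr)
    assume "w \<notin> set xs"
    moreover have "w \<in> verts G" using nbrs_in_verts[OF G w] by blast
    moreover have "(xs @ [w]) ! Suc i \<in> nbrs G ((xs @ [w]) ! i)" if "Suc i < length (xs @ [w])" for i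
    proof (cases "Suc i < length xs")
      case True
      thus ?thesis using xs by (auto simp: path_in_def nth_append)
    next
      case False
      hence "length xs = Suc i" using that by simp
      thus ?thesis using w xs by (simp add: nth_append last_conv_nth)
    qed
    ultimately have "?P (xs @ [w])" using xs by (auto simp: path_in_def nth_append)
    thus False using max[of "xs @ [w]"] by simp
  qed
  thus ?thesis using that xs by blast
qed

text \<open>Predecessor and successor are distinct neighbours and already exhaust the
  degree.\<close>

lemma path_in_inner_nbrs:
  assumes G: "signed_graph G" and p: "path_in G xs" and i: "Suc (Suc i) < length xs"
    and d: "card (nbrs G (xs ! Suc i)) \<le> 2"
  shows "nbrs G (xs ! Suc i) = {xs ! i, xs ! Suc (Suc i)}"
proof -
  have "{xs ! i, xs ! Suc (Suc i)} \<subseteq> nbrs G (xs ! Suc i)"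
    using p i nbrs_commute[of "xs ! i" G] by (auto simp: path_in_def)
  moreover have "xs ! i \<noteq> xs ! Suc (Suc i)"
    using p i by (simp add: path_in_def nth_eq_iff_index_eq)
  ultimately show ?thesis
    using card_seteq[OF finite_nbrs[OF G]] d by (metis card_2_iff)
qed

text \<open>An inner vertex has no neighbours besides its predecessor and successor, so it is joined
  to the last vertex only when next to it.\<close>

lemma path_in_last_nbr:
  assumes G: "signed_graph G" and p: "path_in G xs" and j: "j < length xs"
    and d: "\<And>u. u \<in> set xs \<Longrightarrow> card (nbrs G u) \<le> 2"
    and w: "xs ! j \<in> nbrs G (last xs)"
  shows "j = 0 \<or> Suc (Suc j) = length xs"
proof (rule ccontr)
  assume "\<not> ?thesis"
  then obtain i where i: "j = Suc i" "Suc j \<noteq> length xs - 1" by (cases j) auto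
  have last: "last xs = xs ! (length xs - 1)" using j by (intro last_conv_nth) auto
  have "j \<noteq> length xs - 1" using w not_in_nbrs_self[OF G] last by metis
  hence l: "Suc j < length xs" using j by linarith
  have "xs ! (length xs - 1) \<in> nbrs G (xs ! j)" using w last nbrs_commute by metis
  hence "xs ! (length xs - 1) \<in> {xs ! i, xs ! Suc (Suc i)}"
    using path_in_inner_nbrs[OF G p, of i] i(1) l d[of "xs ! j"] j by simp
  hence "length xs - 1 = i \<or> length xs - 1 = Suc (Suc i)"
    using p i l by (auto simp: path_in_def nth_eq_iff_index_eq)
  thus False using i l by auto
qed

text \<open>The last vertex can be joined only to the first one or to its own predecessor. Since the
  first has the single neighbour \<open>xs ! 1\<close>, the former happens only on two vertices,
  where the two options agree.\<close>

lemma maximal_path_end_nbrs: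
  assumes G: "signed_graph G" and p: "path_in G xs" and ne: "xs \<noteq> []"
    and d: "\<And>u. u \<in> set xs \<Longrightarrow> card (nbrs G u) \<in> {1, 2}"
    and s: "card (nbrs G (xs ! 0)) = 1" and max: "nbrs G (last xs) \<subseteq> set xs"
  shows "length xs \<ge> 2" "nbrs G (xs ! 0) = {xs ! 1}" "nbrs G (last xs) = {xs ! (length xs - 2)}"
proof -
  show len: "length xs \<ge> 2"
  proof (rule ccontr)
    assume "\<not> ?thesis"
    hence "length xs = 1" using ne length_greater_0_conv[of xs] by linarith
    then obtain x where x: "xs = [x]" by (cases xs) auto
    hence "nbrs G x = {}" using max not_in_nbrs_self[OF G, of x] by auto
    thus False using s x by simp
  qed
  have "xs ! 1 \<in> nbrs G (xs ! 0)" using p len by (auto simp: path_in_def)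
  thus first: "nbrs G (xs ! 0) = {xs ! 1}" using s by (auto simp: card_1_singleton_iff)
  have "w = xs ! (length xs - 2)" if w: "w \<in> nbrs G (last xs)" for w
  proof -
    obtain j where j: "j < length xs" "w = xs ! j" using max w by (metis in_set_conv_nth subsetD)
    have "card (nbrs G u) \<le> 2" if "u \<in> set xs" for u using d[OF that] by auto
    hence "j = 0 \<or> Suc (Suc j) = length xs" using path_in_last_nbr[OF G p j(1)] w j(2) by blast
    thus ?thesis
    proof
      assume "j = 0"
      hence "last xs \<in> nbrs G (xs ! 0)" using w j(2) nbrs_commute by metis
      hence "xs ! (length xs - 1) = xs ! 1" using first ne by (simp add: last_conv_nth)
      hence "length xs = 2" using p len by (simp add: path_in_def nth_eq_iff_index_eq)
      thus ?thesis using \<open>j = 0\<close> j(2) by simp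
    next
      assume "Suc (Suc j) = length xs"
      hence "j = length xs - 2" by simp
      thus ?thesis using j(2) by simp
    qed
  qed
  moreover have "nbrs G (last xs) \<noteq> {}" using d[of "last xs"] ne by auto
  ultimately show "nbrs G (last xs) = {xs ! (length xs - 2)}" by blast
qed

text \<open>Degree two forces the last vertex to be joined to both possible vertices, its
  predecessor and the first one, which closes the path to a cycle.\<close>

lemma maximal_path_cycle_nbrs:
  assumes G: "signed_graph G" and p: "path_in G xs" and ne: "xs \<noteq> []"
    and d: "\<And>u. u \<in> set xs \<Longrightarrow> card (nbrs G u) = 2" and max: "nbrs G (last xs) \<subseteq> set xs"
  shows "length xs \<ge> 3" "nbrs G (xs ! 0) = {xs ! (length xs - 1), xs ! 1}"
    "nbrs G (xs ! (length xs - 1)) = {xs ! (length xs - 2), xs ! 0}"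
proof -
  let ?a = "length xs"
  have l: "last xs = xs ! (?a - 1)" using ne by (simp add: last_conv_nth)
  have sub: "nbrs G (last xs) \<subseteq> {xs ! (?a - 2), xs ! 0}"
  proof
    fix w assume w: "w \<in> nbrs G (last xs)"
    obtain j where j: "j < ?a" "w = xs ! j" using max w by (metis in_set_conv_nth subsetD)
    have "j = 0 \<or> Suc (Suc j) = ?a" using path_in_last_nbr[OF G p j(1)] w j(2) d by simp
    hence "j = 0 \<or> j = ?a - 2" by linarith
    thus "w \<in> {xs ! (?a - 2), xs ! 0}" using j(2) by auto
  qed
  have c2: "card (nbrs G (last xs)) = 2" using d[of "last xs"] ne by simp
  have "card {xs ! (?a - 2), xs ! 0} \<le> 2" by (simp add: card_insert_if)
  hence eq: "nbrs G (last xs) = {xs ! (?a - 2), xs ! 0}"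
    using sub c2 by (intro card_seteq) auto
  thus "nbrs G (xs ! (?a - 1)) = {xs ! (?a - 2), xs ! 0}" unfolding l .
  have "xs ! (?a - 2) \<noteq> xs ! 0" using c2 unfolding eq by (auto simp: card_insert_if split: if_splits)
  \<comment> \<open>On fewer than three vertices the truncated difference is 0 and both candidates
    would be \<open>xs ! 0\<close>.\<close>
  hence "?a - 2 \<noteq> 0" by metis
  thus len: "?a \<ge> 3" by linarith
  have "xs ! 0 \<in> nbrs G (xs ! (?a - 1))" using eq unfolding l by simp
  hence "xs ! (?a - 1) \<in> nbrs G (xs ! 0)" using nbrs_commute by metis
  moreover have "xs ! 1 \<in> nbrs G (xs ! 0)" using p len by (auto simp: path_in_def)
  moreover have "xs ! (?a - 1) \<noteq> xs ! 1" using p len by (simp add: path_in_def nth_eq_iff_index_eq)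
  moreover have "card (nbrs G (xs ! 0)) = 2" using d[of "xs ! 0"] ne by simp
  ultimately show "nbrs G (xs ! 0) = {xs ! (?a - 1), xs ! 1}"
    using card_seteq[OF finite_nbrs[OF G], of "{xs ! (?a - 1), xs ! 1}" "xs ! 0"] by simp
qed

section \<open>Vanishing of eigenfunctions on path and cycle components\<close>

lemma eigenfun_zero_on_path_component:
  assumes G: "signed_graph G" and ev: "eigenfun G (2 * cos t) f"
    and p: "path_in G xs" and len: "length xs \<ge> 2"
    and d: "\<And>u. u \<in> set xs \<Longrightarrow> card (nbrs G u) \<le> 2"
    and N0: "nbrs G (xs ! 0) = {xs ! 1}" and Nl: "nbrs G (last xs) = {xs ! (length xs - 2)}"
    and t: "sin t \<noteq> 0" "sin (real (Suc (length xs)) * t) \<noteq> 0" and u: "u \<in> set xs"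
  shows "f u = 0"
proof -
  define a where "a = length xs"
  let ?y = "\<lambda>i. xs ! i" and ?s = "sign_along G (\<lambda>i. xs ! i)"
  \<comment> \<open>The sign-adjusted eigenfunction is shifted by one place, with zeros added at 0
    and a + 1. The equations at the two ends then take the form of the recurrence with these
    boundary zeros.\<close>
  define g where "g i = (if i = 0 \<or> i > a then 0 else ?s (i - 1) * f (xs ! (i - 1)))" for i
  have inV: "xs ! i \<in> verts G" if "i < a" for i
    using p that by (auto simp: path_in_def a_def)
  have step: "xs ! Suc i \<in> nbrs G (xs ! i)" if "Suc i < a" for i
    using p that by (auto simp: path_in_def a_def)
  obtain b where b: "a = Suc (Suc b)" using len unfolding a_def by (metis Suc_le_D numeral_2_eq_2 Suc_le_mono)
  have last: "last xs = xs ! Suc b" using b len by (subst last_conv_nth) (auto simp: a_def)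
  have rec: "g (Suc (Suc i)) = 2 * cos t * g (Suc i) - g i" if i: "i < a" for i
  proof -
    \<comment> \<open>Here \<open>i\<close> is the position in \<open>xs\<close> of the vertex whose
      eigenvalue equation is used: first, inner or last.\<close>
    consider "i = 0" | j where "i = Suc j" "Suc i < a" | "i = Suc b"
      using i b by (cases i) (auto, linarith)
    thus ?thesis
    proof cases
      case 1
      have "adj G (xs ! 0) (xs ! 1) * f (xs ! 1) = 2 * cos t * f (xs ! 0)"
        using eigenfun_eq[OF G ev inV[of 0]] b unfolding N0 by simp
      thus ?thesis using 1 b by (simp add: g_def)
    next
      case (2 j)
      have N: "nbrs G (xs ! Suc j) = {xs ! j, xs ! Suc (Suc j)}"
        using path_in_inner_nbrs[OF G p] d 2 by (simp add: a_def)
      have "xs ! j \<noteq> xs ! Suc (Suc j)"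
        using p 2 by (simp add: path_in_def nth_eq_iff_index_eq a_def)
      from eigenfun_recurrence[of G "2 * cos t" f ?y j, OF G ev N this]
      show ?thesis using 2 by (simp add: g_def)
    next
      case 3
      have m: "xs ! Suc b \<in> nbrs G (xs ! b)" using step b by simp
      have "adj G (xs ! Suc b) (xs ! b) * f (xs ! b) = 2 * cos t * f (xs ! Suc b)"
        using eigenfun_eq[OF G ev inV[of "Suc b"]] b Nl unfolding last a_def[symmetric] by simp
      hence "?s (Suc b) * adj G (xs ! Suc b) (xs ! b) * f (xs ! b) = 2 * cos t * (?s (Suc b) * f (xs ! Suc b))"
        by (metis (no_types, opaque_lifting) mult.assoc mult.left_commute)
      hence "?s b * f (xs ! b) = 2 * cos t * (?s (Suc b) * f (xs ! Suc b))"
        unfolding sign_along_step_back[of G ?y b, OF G m] .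
      moreover have "g (Suc (Suc i)) = 0" "g (Suc i) = ?s (Suc b) * f (xs ! Suc b)" "g i = ?s b * f (xs ! b)"
        using 3 b by (simp_all add: g_def del: sign_along_simps)
      ultimately show ?thesis by (simp only: diff_self)
    qed
  qed
  obtain i where i: "i < a" "u = xs ! i" using u unfolding in_set_conv_nth a_def by blast
  have "g (Suc i) = 0"
    using dirichlet_recurrence_zero[of a g t "Suc i", OF rec] t i(1) by (simp add: g_def a_def)
  moreover have "?s i \<noteq> 0"
    using sign_along_cases[of G i ?y, OF G step] i(1) by auto
  ultimately show ?thesis using i by (simp add: g_def)
qed

text \<open>The cycle is traversed periodically. The function repeats after one turn, but the
  accumulated sign need not, so the adjusted sequence is only quasiperiodic. The starting vertex
  suffices, as it may be chosen anywhere on the cycle.\<close>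

lemma eigenfun_zero_on_cycle_component:
  assumes G: "signed_graph G" and ev: "eigenfun G (2 * cos t) f"
    and p: "path_in G xs" and len: "length xs \<ge> 3"
    and d: "\<And>u. u \<in> set xs \<Longrightarrow> card (nbrs G u) = 2"
    and N0: "nbrs G (xs ! 0) = {xs ! (length xs - 1), xs ! 1}"
    and Nl: "nbrs G (xs ! (length xs - 1)) = {xs ! (length xs - 2), xs ! 0}"
    and t: "sin t \<noteq> 0" "sin (real (length xs) * t) \<noteq> 0"
  shows "f (xs ! 0) = 0"
proof -
  define k where "k = length xs"
  define y where "y i = xs ! (i mod k)" for i
  let ?s = "sign_along G y"
  define g where "g i = ?s i * f (y i)" for i
  have k: "k \<ge> 3" using len by (simp add: k_def)
  have y_in: "y i \<in> set xs" for i
    unfolding y_def using k by (intro nth_mem) (simp add: k_def[symmetric])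
  have N: "nbrs G (y (Suc i)) = {y i, y (Suc (Suc i))}" for i
  proof -
    define j where "j = i mod k"
    have j: "j < k" using k by (simp add: j_def)
    have y: "y i = xs ! j" "y (Suc i) = xs ! (if Suc j = k then 0 else Suc j)"
      "y (Suc (Suc i)) = xs ! (if Suc j = k then 1 else if Suc (Suc j) = k then 0 else Suc (Suc j))"
      using k by (auto simp: y_def j_def mod_Suc)
    consider "Suc j = k" | "Suc (Suc j) = k" | "Suc (Suc j) < k" using j by linarith
    thus ?thesis
    proof cases
      case 1
      hence "length xs - 1 = j" by (simp add: k_def)
      thus ?thesis using N0 1 unfolding y by simp
    next
      case 2
      hence "length xs - 1 = Suc j" "length xs - 2 = j" by (simp_all add: k_def)
      thus ?thesis using Nl 2 unfolding y by simp
    next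
      case 3
      thus ?thesis using path_in_inner_nbrs[OF G p, of j] d unfolding y by (simp add: k_def)
    qed
  qed
  have ne: "y i \<noteq> y (Suc (Suc i))" for i
    using d[OF y_in, of "Suc i"] unfolding N by (auto simp: card_insert_if split: if_splits)
  have rec: "g (Suc (Suc i)) = 2 * cos t * g (Suc i) - g i" for i
    unfolding g_def by (rule eigenfun_recurrence[of G "2 * cos t" f y i, OF G ev N ne])
  have yk: "y k = y 0" "y (Suc k) = y 1" using k by (simp_all add: y_def mod_Suc)
  \<comment> \<open>The factor \<open>?s k\<close> is the product of the signs around the whole
    cycle.\<close>
  have "g k = ?s k * g 0" "g (Suc k) = ?s k * g 1"
    by (simp_all add: g_def yk)
  hence "g 0 = 0"
    using quasiperiodic_recurrence_zero[of g t k "?s k", OF rec] t by (simp add: k_def)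
  thus ?thesis using k by (simp add: g_def y_def)
qed

section \<open>Recognizing the path up to switching\<close>

lemma switching_isomorphic_path_graph:
  fixes G :: "'a sgraph"
  assumes G: "signed_graph G" and p: "distinct xs" "set xs = verts G"
    and E: "edges G = {{xs ! i, xs ! Suc i} | i. Suc i < length xs}"
  shows "switching_isomorphic G (path_graph (length xs))"
proof -
  let ?n = "length xs" and ?s = "sign_along G (\<lambda>i. xs ! i)"
  have step: "xs ! Suc i \<in> nbrs G (xs ! i)" if "Suc i < ?n" for i
    using E that by (auto simp: nbrs_def)
  have s: "?s i = 1 \<or> ?s i = -1" if "i < ?n" for i
    using sign_along_cases[of G i "\<lambda>i. xs ! i", OF G step] that by simp
  \<comment> \<open>The partial sign product changes along an edge exactly when that edge is
    negative, so switching at the vertices with product -1 makes every edge positive.\<close>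
  define X where "X = {xs ! i | i. i < ?n \<and> ?s i = -1}"
  have inX: "xs ! i \<in> X \<longleftrightarrow> ?s i = -1" if "i < ?n" for i
    using that p(1) by (auto simp: X_def nth_eq_iff_index_eq)
  have bij: "bij_betw ((!) xs) {..<?n} (verts G)"
    using p by (auto intro: bij_betw_nth)
  define f where "f = the_inv_into {..<?n} ((!) xs)"
  have f: "f (xs ! i) = i" if "i < ?n" for i
    unfolding f_def using bij that by (intro the_inv_into_f_f) (auto simp: bij_betw_def)
  have sign: "edge_sign (switch X G) {xs ! i, xs ! Suc i} = 1" if i: "Suc i < ?n" for i
  proof -
    have ne: "xs ! i \<noteq> xs ! Suc i" using i p(1) by (simp add: nth_eq_iff_index_eq)
    have "card ({xs ! i, xs ! Suc i} \<inter> X) = 1 \<longleftrightarrow> (?s i = -1) \<noteq> (?s (Suc i) = -1)"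
      using ne inX[of i] inX[of "Suc i"] i by (auto simp: Int_insert_left simp del: sign_along_simps)
    moreover have "real_of_int (edge_sign G {xs ! i, xs ! Suc i}) = adj G (xs ! i) (xs ! Suc i)"
      using step[OF i] by (simp add: adj_def nbrs_def)
    moreover have "adj G (xs ! i) (xs ! Suc i) = 1 \<or> adj G (xs ! i) (xs ! Suc i) = -1"
      using adj_nbrs_cases[OF G step[OF i]] .
    ultimately show ?thesis using s[of i] i by (auto simp: switch_def)
  qed
  have "bij_betw f (verts (switch X G)) (verts (path_graph ?n))"
    unfolding f_def using bij_betw_the_inv_into[OF bij] by (simp add: switch_def verts_path_graph)
  moreover have "edges (path_graph ?n) = (\<lambda>e. f ` e) ` edges (switch X G)"
  proof -
    have "edges (switch X G) = (\<lambda>i. {xs ! i, xs ! Suc i}) ` {i. Suc i < ?n}"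
      by (auto simp: switch_def E)
    hence "(\<lambda>e. f ` e) ` edges (switch X G) = (\<lambda>i. f ` {xs ! i, xs ! Suc i}) ` {i. Suc i < ?n}"
      by (simp only: image_image)
    also have "\<dots> = (\<lambda>i. {i, Suc i}) ` {i. Suc i < ?n}"
      by (intro image_cong) (auto simp: f)
    finally show ?thesis by (auto simp: path_graph_def)
  qed
  moreover have "edge_sign (path_graph ?n) (f ` e) = edge_sign (switch X G) e"
    if e: "e \<in> edges (switch X G)" for e
  proof -
    obtain i where "Suc i < ?n" "e = {xs ! i, xs ! Suc i}" using e E by (auto simp: switch_def)
    thus ?thesis using sign by (simp add: path_graph_def)
  qed
  ultimately have "isomorphic (switch X G) (path_graph ?n)"
    unfolding isomorphic_def by blast
  moreover have "X \<subseteq> verts G" unfolding p(2)[symmetric] X_def by auto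
  ultimately show ?thesis unfolding switching_isomorphic_def by blast
qed

lemma edges_of_path_component:
  assumes G: "signed_graph G" and p: "path_in G xs" and V: "set xs = verts G"
    and len: "length xs \<ge> 2"
    and d: "\<And>u. u \<in> set xs \<Longrightarrow> card (nbrs G u) \<le> 2"
    and N0: "nbrs G (xs ! 0) = {xs ! 1}" and Nl: "nbrs G (last xs) = {xs ! (length xs - 2)}"
  shows "edges G = {{xs ! i, xs ! Suc i} | i. Suc i < length xs}"
proof
  show "{{xs ! i, xs ! Suc i} | i. Suc i < length xs} \<subseteq> edges G"
    using p by (auto simp: path_in_def nbrs_def)
  show "edges G \<subseteq> {{xs ! i, xs ! Suc i} | i. Suc i < length xs}"
  proof
    fix e assume e: "e \<in> edges G"
    then obtain u w where uw: "e = {u, w}" "u \<in> verts G"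
      using G by (fastforce simp: signed_graph_def card_2_iff)
    have w: "w \<in> nbrs G u" using e uw by (simp add: nbrs_def)
    obtain i where i: "i < length xs" "u = xs ! i" using uw(2) unfolding V[symmetric] in_set_conv_nth by blast
    have l: "last xs = xs ! (length xs - 1)" using len by (intro last_conv_nth) auto
    consider "i = 0" | "i = length xs - 1" | j where "i = Suc j" "Suc (Suc j) < length xs"
      using i(1) by (cases i) (auto, linarith)
    thus "e \<in> {{xs ! i, xs ! Suc i} | i. Suc i < length xs}"
    proof cases
      case 1
      hence "e = {xs ! 0, xs ! Suc 0}" using w N0 uw i by simp
      thus ?thesis using len by force
    next
      case 2
      hence "w = xs ! (length xs - 2)" using w Nl i l by simp
      moreover have "Suc (length xs - 2) = length xs - 1" using len by simp
      ultimately have "e = {xs ! (length xs - 2), xs ! Suc (length xs - 2)}"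
        using uw i 2 by auto
      moreover have "Suc (length xs - 2) < length xs" using len by simp
      ultimately show ?thesis by blast
    next
      case (3 j)
      hence "nbrs G u = {xs ! j, xs ! Suc (Suc j)}"
        using path_in_inner_nbrs[OF G p, of j] d i by simp
      hence "e = {xs ! j, xs ! Suc j} \<or> e = {xs ! Suc j, xs ! Suc (Suc j)}"
        using w uw i 3 by auto
      thus ?thesis using 3 by auto
    qed
  qed
qed

section \<open>Excluding induced unbalanced 4-cycles\<close>

text \<open>Without chords the four given edges are all the induced ones, and a sign product of -1
  means an odd number of negative signs.\<close>

lemma unbalanced_quadrangle_induced:
  fixes G :: "'a sgraph"
  assumes G: "signed_graph G"
    and e: "b \<in> nbrs G a" "c \<in> nbrs G b" "d \<in> nbrs G c" "a \<in> nbrs G d"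
    and ne: "a \<noteq> c" "b \<noteq> d" and nc: "c \<notin> nbrs G a" "d \<notin> nbrs G b"
    and unb: "adj G a b * adj G b c * adj G c d * adj G d a = -1"
  shows "unbalanced_cycle 4 (induced_subgraph G {a, b, c, d})"
proof -
  let ?X = "{a, b, c, d}" and ?E = "{{a, b}, {b, c}, {c, d}, {d, a}}"
  have ne': "a \<noteq> b" "a \<noteq> d" "b \<noteq> c" "c \<noteq> d" using not_in_nbrs_self[OF G] e by auto
  have in_E: "{u, w} \<in> ?E" if "w \<in> nbrs G u" "u \<in> ?X" "w \<in> ?X" for u w
    using that nc nbrs_commute[of _ G] not_in_nbrs_self[OF G] by (auto simp: insert_commute)
  have "{x \<in> edges G. x \<subseteq> ?X} \<subseteq> ?E"
  proof
    fix x assume "x \<in> {x \<in> edges G. x \<subseteq> ?X}"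
    hence x: "x \<in> edges G" "x \<subseteq> ?X" by auto
    hence "card x = 2" using G by (simp add: signed_graph_def)
    then obtain u w where uw: "x = {u, w}" by (auto simp: card_2_iff)
    have "w \<in> nbrs G u" using x(1) by (simp add: uw nbrs_def)
    moreover have "u \<in> ?X" "w \<in> ?X" using x(2) unfolding uw by simp_all
    ultimately show "x \<in> ?E" unfolding uw by (rule in_E)
  qed
  moreover have "?E \<subseteq> {x \<in> edges G. x \<subseteq> ?X}" using e by (auto simp: nbrs_def)
  ultimately have E: "edges (induced_subgraph G ?X) = ?E" by (simp add: induced_subgraph_def)
  have V: "verts (induced_subgraph G ?X) = ?X"
    and S: "edge_sign (induced_subgraph G ?X) = edge_sign G"
    by (simp_all add: induced_subgraph_def)
  have four: "{..<4 :: nat} = {0, 1, 2, 3}" by auto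
  define f where "f i = [a, b, c, d] ! i" for i :: nat
  have f: "f 0 = a" "f 1 = b" "f (Suc 0) = b" "f 2 = c" "f 3 = d" by (simp_all add: f_def)
  have "bij_betw f {..<4} ?X"
    unfolding four bij_betw_def using ne ne' by (auto simp: f)
  moreover have "?E = (\<lambda>i. {f i, f (Suc i mod 4)}) ` {..<4}"
    unfolding four by (simp add: f numeral_2_eq_2[symmetric] numeral_3_eq_3[symmetric])
  ultimately have cyc: "is_cycle 4 (induced_subgraph G ?X)"
    unfolding is_cycle_def E V by auto
  have dist: "{a, b} \<noteq> {b, c}" "{a, b} \<noteq> {c, d}" "{a, b} \<noteq> {d, a}" "{b, c} \<noteq> {c, d}"
    "{b, c} \<noteq> {d, a}" "{c, d} \<noteq> {d, a}"
    using ne ne' by (auto simp: doubleton_eq_iff)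
  let ?s = "\<lambda>x. if edge_sign G x = -1 then 1 else 0 :: nat"
  \<comment> \<open>The four edges are distinct, so the count is a sum of four indicators whose
    parity can be checked case by case.\<close>
  have "card {x \<in> ?E. edge_sign G x = -1} = sum ?s ?E"
    unfolding card_eq_sum by (rule sum.inter_filter) simp
  also have "\<dots> = ?s {a, b} + ?s {b, c} + ?s {c, d} + ?s {d, a}"
    using dist by simp
  finally have card: "card {x \<in> ?E. edge_sign G x = -1} = ?s {a, b} + ?s {b, c} + ?s {c, d} + ?s {d, a}" .
  have sgn: "edge_sign G {u, w} = (if adj G u w = 1 then 1 else -1) \<and> (adj G u w = 1 \<or> adj G u w = -1)"
    if "w \<in> nbrs G u" for u w
    using adj_nbrs_cases[OF G that] that by (auto simp: adj_def nbrs_def)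
  have "odd (card {x \<in> ?E. edge_sign G x = -1})"
    unfolding card using sgn[OF e(1)] sgn[OF e(2)] sgn[OF e(3)] sgn[OF e(4)] unb by auto
  thus ?thesis using cyc unfolding unbalanced_cycle_def E S by simp
qed

text \<open>For a degree d, (d - 1) (d - 2) equals ((2 \<open>d\<^sup>2\<close> - d) - 5 d) / 2 + 2,
  where 2 \<open>d\<^sup>2\<close> - d and d sum to the traces of the fourth and the second power.
  Under \<open>one\<close> the sum is thus determined by the spectrum.\<close>

lemma sum_degree_polynomial:
  assumes G: "signed_graph G"
    and one: "\<And>u v. u \<in> verts G \<Longrightarrow> v \<in> verts G \<Longrightarrow> u \<noteq> v \<Longrightarrow> card (nbrs G u \<inter> nbrs G v) \<le> 1"
  shows "(\<Sum>u\<in>verts G. (real (card (nbrs G u)) - 1) * (real (card (nbrs G u)) - 2))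
    = ((\<Sum>u\<in>verts G. walks G 4 u u) - 5 * (\<Sum>u\<in>verts G. walks G 2 u u)) / 2 + 2 * real (card (verts G))"
proof -
  have sum: "(\<Sum>u\<in>A. (g u - 5 * h u) / 2 + 2) = (sum g A - 5 * sum h A) / 2 + 2 * real (card A)"
    for g h :: "'a \<Rightarrow> real" and A
    by (simp add: sum.distrib sum_subtractf sum_distrib_left flip: sum_divide_distrib)
  have walks4: "(\<Sum>u\<in>verts G. walks G 4 u u)
      = (\<Sum>u\<in>verts G. 2 * (real (card (nbrs G u)))\<^sup>2 - real (card (nbrs G u)))"
    by (rule sum_walks_4[OF G]) (rule one)
  show ?thesis
    unfolding walks4 sum_walks_2[OF G] sum[symmetric]
    by (intro sum.cong refl) (simp add: field_simps power2_eq_square)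
qed

text \<open>The maximal path from a vertex of degree 1 uses up both such vertices, so every other
  component is a cycle. If the path missed a vertex, \<open>f\<close> would vanish both on it and on
  the cycles.\<close>

lemma degree_one_or_two_imp_path:
  fixes G :: "'a sgraph" and n :: nat
  defines "t \<equiv> pi / (real n + 1)"
  assumes G: "signed_graph G" and n: "card (verts G) = n"
    and d: "\<And>u. u \<in> verts G \<Longrightarrow> card (nbrs G u) \<in> {1, 2}"
    and two: "card {u \<in> verts G. card (nbrs G u) = 1} = 2"
    and ev: "eigenfun G (2 * cos t) f"
  shows "switching_isomorphic G (path_graph n)"
proof -
  have fin: "finite (verts G)" using G by (simp add: signed_graph_def)
  obtain s where s: "s \<in> verts G" "card (nbrs G s) = 1"
    using two by (metis (mono_tags, lifting) Collect_empty_eq card.empty zero_neq_numeral)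
  obtain xs where p: "path_in G xs" "xs \<noteq> []" "xs ! 0 = s" "nbrs G (last xs) \<subseteq> set xs"
    using ex_maximal_path[OF G s(1)] .
  have xsV: "set xs \<subseteq> verts G" and dist: "distinct xs" using p(1) by (auto simp: path_in_def)
  have dxs: "card (nbrs G u) \<in> {1, 2}" if "u \<in> set xs" for u using d xsV that by blast
  have dxs2: "card (nbrs G u) \<le> 2" if "u \<in> set xs" for u using dxs[OF that] by auto
  have s1: "card (nbrs G (xs ! 0)) = 1" using s(2) p(3) by simp
  have len: "length xs \<ge> 2" and N0: "nbrs G (xs ! 0) = {xs ! 1}"
    and Nl: "nbrs G (last xs) = {xs ! (length xs - 2)}"
    using maximal_path_end_nbrs[OF G p(1,2) dxs s1 p(4)] by auto
  have n_pos: "n \<ge> 1" using s(1) fin n card_gt_0_iff[of "verts G"] by auto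
  \<comment> \<open>These are entries of the positive eigenvector of the path, at position
    \<open>k - 1\<close>. The range covers all cycle lengths and, once \<open>length xs < n\<close>,
    also \<open>Suc (length xs)\<close>.\<close>
  have sin: "sin (real k * t) \<noteq> 0" if "1 \<le> k" "k \<le> n" for k
  proof -
    have "k - 1 < n" using that by linarith
    from eigenfun_path_graph(2)[OF n_pos this] show ?thesis
      using that by (simp add: t_def of_nat_diff)
  qed
  have sin1: "sin t \<noteq> 0" using sin[of 1] n_pos by simp
  have "length xs = n"
  proof (rule ccontr)
    assume "length xs \<noteq> n"
    hence less: "length xs < n" using card_mono[OF fin xsV] distinct_card[OF dist] n by simp
    have zero: "f u = 0" if "u \<in> set xs" for u
      using eigenfun_zero_on_path_component[OF G ev p(1) len dxs2 N0 Nl sin1 sin that] less by simp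
    obtain y where y: "y \<in> verts G" "f y \<noteq> 0" using ev by (auto simp: eigenfun_def)
    obtain ys where q: "path_in G ys" "ys \<noteq> []" "ys ! 0 = y" "nbrs G (last ys) \<subseteq> set ys"
      using ex_maximal_path[OF G y(1)] .
    have ends: "{u \<in> verts G. card (nbrs G u) = 1} = {xs ! 0, last xs}"
    proof (rule card_seteq[symmetric])
      have "xs ! 0 \<noteq> last xs" using len dist p(2) by (simp add: last_conv_nth nth_eq_iff_index_eq)
      thus "card {u \<in> verts G. card (nbrs G u) = 1} \<le> card {xs ! 0, last xs}" using two by simp
      show "{xs ! 0, last xs} \<subseteq> {u \<in> verts G. card (nbrs G u) = 1}"
        using N0 Nl xsV p(2,3) s(1) by (auto intro: last_in_set)
    qed (use fin in simp)
    have closed: "w \<in> set xs" if u: "u \<in> set xs" and w: "w \<in> nbrs G u" for u w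
    proof -
      obtain i where i: "i < length xs" "u = xs ! i" using u unfolding in_set_conv_nth by blast
      consider "i = 0" | "i = length xs - 1" | j where "i = Suc j" "Suc (Suc j) < length xs"
        using i(1) by (cases i) (auto, linarith)
      thus ?thesis
      proof cases
        case 1
        thus ?thesis using w N0 i(2) len by simp
      next
        case 2
        thus ?thesis using w Nl i(2) len p(2) by (simp add: last_conv_nth)
      next
        case (3 j)
        thus ?thesis using path_in_inner_nbrs[OF G p(1), of j] dxs2[OF u] w i by auto
      qed
    qed
    \<comment> \<open>The path \<open>ys\<close> starts off \<open>xs\<close>, where
      \<open>f\<close> is nonzero, and cannot enter a set closed under neighbours.\<close>
    have out: "i < length ys \<Longrightarrow> ys ! i \<notin> set xs" for i
    proof (induction i)
      case 0
      show ?case using y zero q(3) by auto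
    next
      case (Suc i)
      have "ys ! i \<in> nbrs G (ys ! Suc i)"
        using q(1) Suc.prems nbrs_commute[of "ys ! i" G] by (simp add: path_in_def)
      thus ?case using closed Suc by auto
    qed
    have ysV: "set ys \<subseteq> verts G" using q(1) by (simp add: path_in_def)
    have d2: "card (nbrs G u) = 2" if u: "u \<in> set ys" for u
    proof -
      obtain i where "i < length ys" "u = ys ! i" using u unfolding in_set_conv_nth by blast
      hence "u \<notin> set xs" using out by blast
      moreover have "xs ! 0 \<in> set xs" "last xs \<in> set xs" using p(2) by auto
      ultimately have "u \<notin> {u \<in> verts G. card (nbrs G u) = 1}" unfolding ends by blast
      thus ?thesis using d[of u] u ysV by blast
    qed
    have c: "length ys \<ge> 3" "nbrs G (ys ! 0) = {ys ! (length ys - 1), ys ! 1}"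
      "nbrs G (ys ! (length ys - 1)) = {ys ! (length ys - 2), ys ! 0}"
      by (rule maximal_path_cycle_nbrs[OF G q(1,2) _ q(4)], rule d2, assumption)+
    have "length ys \<le> n"
      using card_mono[OF fin ysV] distinct_card[of ys] q(1) n by (simp add: path_in_def)
    hence "sin (real (length ys) * t) \<noteq> 0" using sin c(1) by simp
    hence "f (ys ! 0) = 0"
      using eigenfun_zero_on_cycle_component[OF G ev q(1) c(1) d2 c(2,3) sin1] by blast
    thus False using y q(3) by simp
  qed
  moreover from this have V: "set xs = verts G"
    using card_subset_eq[OF fin xsV] distinct_card[OF dist] n by simp
  have "edges G = {{xs ! i, xs ! Suc i} | i. Suc i < length xs}"
    by (rule edges_of_path_component[OF G p(1) V len _ N0 Nl]) (rule dxs2)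
  hence "switching_isomorphic G (path_graph (length xs))"
    by (rule switching_isomorphic_path_graph[OF G dist V])
  ultimately show ?thesis by simp
qed

theorem theorem3p4:
  fixes n :: nat and \<Gamma> :: "'a sgraph"
  assumes "n \<ge> 1"
    and "signed_graph \<Gamma>"
    and "cospectral \<Gamma> (path_graph n)"
    and "\<not> switching_isomorphic \<Gamma> (path_graph n)"
  shows "\<exists>X\<subseteq>verts \<Gamma>. unbalanced_cycle 4 (induced_subgraph \<Gamma> X)"
proof (rule ccontr)
  assume no: "\<not> ?thesis"
  let ?V = "verts \<Gamma>" and ?P = "path_graph n" and ?d = "\<lambda>u. real (card (nbrs \<Gamma> u))"
  define t where "t = pi / (real n + 1)"
  note G = assms(2)
  note P = signed_graph_path_graph[of n]
  have fin: "finite ?V" "finite (verts ?P)" using G P by (auto simp: signed_graph_def)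
  note co = cospectral_invariants[OF fin assms(3)]
  have card: "card ?V = n" using co(1) by (simp add: verts_path_graph)
  show False
  \<comment> \<open>The single vertex of the path with \<open>n = 1\<close> has degree 0, where (d -
    1) (d - 2) does not vanish.\<close>
  proof (cases "n = 1")
    case True
    then obtain s where s: "?V = {s}" using card by (auto simp: card_1_singleton_iff)
    have "edges \<Gamma> = {}"
    proof (rule ccontr)
      assume "\<not> ?thesis"
      then obtain e where "e \<subseteq> {s}" "card e = 2" using G s by (auto simp: signed_graph_def)
      thus False using card_mono[of "{s}" e] by simp
    qed
    hence "switching_isomorphic \<Gamma> (path_graph (length [s]))"
      using s by (intro switching_isomorphic_path_graph[OF G]) auto
    thus False using assms(4) True by simp
  next
    case False
    hence n: "n \<ge> 2" using assms(1) by simp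
    have t: "0 < t" "t \<le> pi / 2" using n by (auto simp: t_def field_simps)
    have r: "0 \<le> 2 * cos t" "2 * cos t < 2"
      using cos_ge_zero[of t] cos_monotone_0_pi[of 0 t] t by auto
    have evP: "eigenfun ?P (2 * cos t) (\<lambda>i. sin ((real i + 1) * t))"
      unfolding t_def by (rule eigenfun_path_graph(1)[OF assms(1)])
    have "(\<Sum>u\<in>verts ?P. walks ?P k u u) \<le> real (card (verts ?P)) * (2 * cos t) ^ k" for k
    proof (rule sum_walks_diag_le[OF fin(2) _ _ evP])
      show "adj ?P u v \<ge> 0" for u v by (simp add: adj_def path_graph_def)
      show "sin ((real u + 1) * t) > 0" if "u \<in> verts ?P" for u
        unfolding t_def using eigenfun_path_graph(2)[OF assms(1)] that by (simp add: verts_path_graph)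
    qed
    hence tr: "(\<Sum>u\<in>?V. walks \<Gamma> k u u) \<le> real n * (2 * cos t) ^ k" for k
      using co(2)[of k] by (simp add: verts_path_graph)
    note Q = quadratic_form_less_on[OF fin(1) r tr]
    have tri: False if "b \<in> nbrs \<Gamma> a" "c \<in> nbrs \<Gamma> a" "c \<in> nbrs \<Gamma> b" for a b c
      using no_triangle[OF G Q that] .
    \<comment> \<open>Two common neighbours would give a 4-cycle, chordless for lack of triangles,
      hence unbalanced and induced.\<close>
    have one: "card (nbrs \<Gamma> u \<inter> nbrs \<Gamma> v) \<le> 1" if "u \<noteq> v" for u v
    proof (rule ccontr)
      assume "\<not> ?thesis"
      then obtain x y where xy: "x \<in> nbrs \<Gamma> u \<inter> nbrs \<Gamma> v" "y \<in> nbrs \<Gamma> u \<inter> nbrs \<Gamma> v" "x \<noteq> y"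
        using finite_nbrs[OF G] by (auto simp: card_le_Suc0_iff_eq)
      have e: "x \<in> nbrs \<Gamma> u" "v \<in> nbrs \<Gamma> x" "y \<in> nbrs \<Gamma> v" "u \<in> nbrs \<Gamma> y"
        using xy nbrs_commute[of _ \<Gamma>] by blast+
      have nc: "v \<notin> nbrs \<Gamma> u" "y \<notin> nbrs \<Gamma> x" using tri xy by blast+
      have "adj \<Gamma> u x * adj \<Gamma> x v * adj \<Gamma> v y * adj \<Gamma> y u = -1"
        using induced_quadrangle_unbalanced[OF G Q e that xy(3) nc] .
      hence "unbalanced_cycle 4 (induced_subgraph \<Gamma> {u, x, v, y})"
        by (rule unbalanced_quadrangle_induced[OF G e that xy(3) nc])
      moreover have "{u, x, v, y} \<subseteq> ?V" using nbrs_in_verts[OF G] e by blast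
      ultimately show False using no by blast
    qed
    have poly: "(\<Sum>u\<in>?V. (?d u - 1) * (?d u - 2)) =
        ((\<Sum>u\<in>?V. walks \<Gamma> 4 u u) - 5 * (\<Sum>u\<in>?V. walks \<Gamma> 2 u u)) / 2 + 2 * real (card ?V)"
      by (rule sum_degree_polynomial[OF G]) (rule one)
    have "(\<Sum>i\<in>verts ?P. (real (card (nbrs ?P i)) - 1) * (real (card (nbrs ?P i)) - 2)) =
        ((\<Sum>i\<in>verts ?P. walks ?P 4 i i) - 5 * (\<Sum>i\<in>verts ?P. walks ?P 2 i i)) / 2 + 2 * real (card (verts ?P))"
      by (rule sum_degree_polynomial[OF P]) (rule card_common_nbrs_path_graph, auto simp: verts_path_graph)
    hence "(\<Sum>u\<in>?V. (?d u - 1) * (?d u - 2))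
        = (\<Sum>i\<in>verts ?P. (real (card (nbrs ?P i)) - 1) * (real (card (nbrs ?P i)) - 2))"
      unfolding poly co(1) co(2) by (rule sym)
    also have "\<dots> = 0"
      using n by (intro sum.neutral) (auto simp: verts_path_graph card_nbrs_path_graph)
    finally have sum0: "(\<Sum>u\<in>?V. (?d u - 1) * (?d u - 2)) = 0" .
    \<comment> \<open>No integer lies strictly between the roots 1 and 2, so all summands are
      nonnegative and each must vanish.\<close>
    have "(real k - 1) * (real k - 2) \<ge> 0" for k :: nat
      by (cases "k \<le> 1") (auto intro!: mult_nonneg_nonneg mult_nonpos_nonpos)
    hence "(?d u - 1) * (?d u - 2) = 0" if "u \<in> ?V" for u
      using sum0 sum_nonneg_eq_0_iff[OF fin(1), of "\<lambda>u. (?d u - 1) * (?d u - 2)"] that by blast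
    hence d: "card (nbrs \<Gamma> u) \<in> {1, 2}" if "u \<in> ?V" for u using that by fastforce
    \<comment> \<open>The trace of the square transfers the degree sum of the path. The total
      deficit from degree 2 is therefore 2, and only vertices of degree 1 contribute to it, one
      each.\<close>
    have "(\<Sum>u\<in>?V. ?d u) = 2 * real n - 2"
      using sum_walks_2[OF G] sum_walks_2[OF P] co(2)[of 2] sum_card_nbrs_path_graph[OF assms(1)]
      by (simp add: verts_path_graph)
    hence "(\<Sum>u\<in>?V. 2 - ?d u) = 2" by (simp add: sum_subtractf card)
    moreover have "(\<Sum>u\<in>?V. 2 - ?d u) = (\<Sum>u\<in>?V. if card (nbrs \<Gamma> u) = 1 then 1 else 0)"
      using d by (intro sum.cong) auto
    ultimately have two: "card {u \<in> ?V. card (nbrs \<Gamma> u) = 1} = 2"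
      using fin(1) by (simp add: sum.inter_filter[symmetric])
    obtain f where "eigenfun \<Gamma> (2 * cos t) f" using co(3) evP by blast
    hence "switching_isomorphic \<Gamma> (path_graph n)"
      using degree_one_or_two_imp_path[OF G card d two] unfolding t_def by blast
    thus False using assms(4) by contradiction
  qed
qed

end
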